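(* Let $2\le \mathfrak k\le n$ be integers and let $\mathfrak u\in C(\overline{(\mathbb R^+)^{\mathfrak k}\times\mathbb R^{n-\mathfrak k}})$ be an Alexandrov solution of $$\det D^2\mathfrak u=\frac{1}{\prod_{a=1}^{\mathfrak k}x_a}\quad\text{in } (\mathbb R^+)^{\mathfrak k}\times\mathbb R^{n-\mathfrak k},$$ such that $$\mathfrak u=\sum_{a=1}^{\mathfrak k}x_a\ln x_a+\frac12|x''|^2\quad\text{on } \partial\big((\mathbb R^+)^{\mathfrak k}\times\mathbb R^{n-\mathfrak k}\big),$$ and, for some constant $C$, $$\left|\mathfrak u(x)-\sum_{a=1}^{\mathfrak k}x_a\ln x_a-\frac12|x''|^2\right|\le C\,(x_1\cdots x_{\mathfrak k})^{\frac1{\mathfrak k}}\quad\text{in } (\mathbb R^+)^{\mathfrak k}\times\mathbb R^{n-\mathfrak k}.$$ Then $$\mathfrak u(x)=\sum_{a=1}^{\mathfrak k}x_a\ln x_a+\frac12|x''|^2 .$$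
   Context: Here $\mathbb R^+=(0,\infty)$, $x''=(x_{\mathfrak k+1},\dots,x_n)$, and $0\ln 0=0$. An Alexandrov solution is a convex function whose Monge–Ampère measure equals the measure with the given right-hand side as density. *)

theory Defs
  imports "HOL-Analysis.Analysis"
begin

definition subdifferential ::
  "'a::euclidean_space set \<Rightarrow> ('a \<Rightarrow> real) \<Rightarrow> 'a \<Rightarrow> 'a set"
  where "subdifferential \<Omega> u x = {p. \<forall>y\<in>\<Omega>. u y \<ge> u x + p \<bullet> (y - x)}"

text \<open>The image of a Borel set under the subdifferential is Lebesgue measurable but need not be
  Borel, so its size is taken in \<open>lebesgue\<close>. If \<open>\<Omega>\<close> is open and \<open>u\<close> is convex on \<open>\<Omega>\<close>, the set
  function below is a measure on the Borel subsets of \<open>\<Omega>\<close>; otherwise \<open>measure_of\<close>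
  may return the null measure.\<close>

definition monge_ampere_measure ::
  "'a::euclidean_space set \<Rightarrow> ('a \<Rightarrow> real) \<Rightarrow> 'a measure"
  where "monge_ampere_measure \<Omega> u =
    measure_of \<Omega> (sets (restrict_space borel \<Omega>))
      (\<lambda>E. emeasure lebesgue (\<Union>x\<in>E. subdifferential \<Omega> u x))"

definition alexandrov_solution ::
  "'a::euclidean_space set \<Rightarrow> ('a \<Rightarrow> real) \<Rightarrow> ('a \<Rightarrow> real) \<Rightarrow> bool"
  where "alexandrov_solution \<Omega> f u \<longleftrightarrow>
    convex_on \<Omega> u \<and>
    monge_ampere_measure \<Omega> u = density (restrict_space lborel \<Omega>) (\<lambda>x. ennreal (f x))"

text \<open>The set \<open>K\<close> of coordinates plays the role of the first \<open>k\<close> coordinates, with \<open>k = card K\<close>;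
  the coordinates outside \<open>K\<close> make up \<open>x''\<close>.\<close>

definition orthant :: "'n set \<Rightarrow> (real ^ 'n::finite) set"
  where "orthant K = {x. \<forall>a\<in>K. x $ a > 0}"

definition model_solution :: "'n set \<Rightarrow> real ^ 'n::finite \<Rightarrow> real"
  where "model_solution K x =
    (\<Sum>a\<in>K. x $ a * ln (x $ a)) + 1 / 2 * (\<Sum>i\<in>- K. (x $ i)\<^sup>2)"

end

theory Submission
  imports Defs
begin

text \<open>Write \<open>U\<close> for the model solution, \<open>k\<close> for the cardinality of \<open>K\<close> and \<open>g\<close> for the geometric mean of the
coordinates in \<open>K\<close>, so that the hypothesis reads \<open>\<bar>u - U\<bar> \<le> C g\<close>. The proof is a comparison argument
with the barriers
  \<open>v = U \<plusminus> (a g\<^sup>1\<^sup>+\<^sup>\<delta> + b (1 + \<Sum>x\<^sub>i) + (c/2) \<bar>x''\<bar>\<^sup>2)\<close>.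

The perturbation in parentheses exceeds \<open>C g\<close>, hence \<open>\<bar>u - U\<bar>\<close>, outside a compact subset of the open
orthant: the superlinear power wins where \<open>g\<close> is large, the constant \<open>b\<close> wins where \<open>g\<close> is small, and the
remaining terms bound the coordinates. This is lemma \<open>perturbation_dominated_compact\<close>.
Therefore, if \<open>u\<close> were above the upper barrier or below the lower barrier anywhere, the difference would
have an extremum over the whole orthant at some interior point, where a translate of \<open>v\<close> touches \<open>u\<close>.
Alexandrov solutions satisfy the equation in the viscosity sense (lemmas \<open>alexandrov_touching_above\<close> and
\<open>alexandrov_touching_below\<close>): at that point \<open>det D\<^sup>2v\<close> is at least the density \<open>1 / \<Prod>x\<^sub>i\<close> for the upper
barrier, and at most the density for the lower one.

This contradicts an explicit computation. The linear terms do not enter the Hessian, the quadratic term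
costs only a factor \<open>(1 \<plusminus> c)\<^sup>n\<^sup>-\<^sup>k\<close>, and the power of \<open>g\<close> adds a diagonal matrix and a
rank-one matrix. A power \<open>\<Prod>x\<^sub>i\<^sup>\<beta>\<close> with \<open>0 < \<beta> < 1\<close> is a strict supersolution
of the linearised operator \<open>\<Sum>x\<^sub>i \<partial>\<^sub>i\<^sup>2\<close>; a power of \<open>g\<close> with exponent \<open>1 + \<delta>\<close> has \<open>\<beta> = (1 + \<delta>) / k\<close>,
and a superlinear one with \<open>\<beta> < 1\<close> exists precisely because \<open>k \<ge> 2\<close>. The upper barrier is
thus a strict supersolution (\<open>upper_barrier_strict\<close>). For the lower barrier linearisation is not enough,
because the perturbation of the Hessian is not small where \<open>a g\<^sup>\<delta>\<close> is of order \<open>C\<close>; there the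
arithmetic-geometric mean inequality gives a strict subsolution as long as \<open>\<delta>\<close> is small compared with
\<open>1 / (k (1 + C))\<close> (\<open>lower_barrier_strict\<close>).

Since \<open>a\<close>, \<open>b\<close> and \<open>c\<close> can be arbitrarily small, with \<open>c\<close> small compared with the other two, \<open>u = U\<close> in the
orthant.\<close>

section \<open>Change of variables for matrices over an unordered index type\<close>

text \<open>The change of variables theorem is stated for \<open>real ^ 'n\<close> with a well-ordered index type. A copy of
an arbitrary finite type can be given a well-order, and permuting coordinates between the type and its
copy preserves both Lebesgue measure and determinants.\<close>

typedef 'a ordered_copy = "UNIV :: 'a set"
  morphisms original copy ..

instance ordered_copy :: (finite) finite
proof
  have "(UNIV :: 'a ordered_copy set) = range copy"
    using type_definition.Abs_image[OF type_definition_ordered_copy] by (rule sym)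
  then show "finite (UNIV :: 'a ordered_copy set)"
    using finite_imageI[OF finite, of copy "UNIV :: 'a set"] by simp
qed

definition position :: "'a::finite ordered_copy \<Rightarrow> nat"
  where "position = (SOME f. inj f)"

lemma inj_position: "inj position"
proof -
  have "\<exists>f :: 'a::finite ordered_copy \<Rightarrow> nat. inj f"
    using finite_imp_inj_to_nat_seg[OF finite, of "UNIV :: 'a ordered_copy set"] by blast
  then show ?thesis
    unfolding position_def by (rule someI_ex)
qed

instantiation ordered_copy :: (finite) wellorder
begin

definition "x \<le> y \<longleftrightarrow> position x \<le> position y"

definition "x < y \<longleftrightarrow> position x < position y"

instance
proof
  fix P :: "'a ordered_copy \<Rightarrow> bool" and a
  assume step: "\<And>x. (\<And>y. y < x \<Longrightarrow> P y) \<Longrightarrow> P x"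
  show "P a"
  proof (induction a rule: measure_induct_rule[of position])
    case (less x)
    then show ?case
      unfolding less_ordered_copy_def[symmetric] by (rule step)
  qed
next
  fix x y :: "'a ordered_copy"
  assume "x \<le> y" "y \<le> x"
  then show "x = y"
    unfolding less_eq_ordered_copy_def by (intro injD[OF inj_position]) simp
qed (unfold less_eq_ordered_copy_def less_ordered_copy_def, linarith+)

end

definition reindex :: "('m \<Rightarrow> 'n) \<Rightarrow> real ^ 'n \<Rightarrow> real ^ 'm"
  where "reindex f x = (\<chi> j. x $ f j)"

lemma bounded_linear_reindex: "bounded_linear (reindex f :: real ^ 'n::finite \<Rightarrow> real ^ 'm::finite)"
  unfolding linear_conv_bounded_linear[symmetric]
  by (rule linearI) (simp_all add: reindex_def vec_eq_iff)

lemma reindex_inverse: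
  assumes "bij f"
  shows "reindex (inv f) (reindex f x) = x" "reindex f (reindex (inv f) y) = y"
  using assms by (simp_all add: reindex_def vec_eq_iff bij_inv_eq_iff bij_is_inj surj_f_inv_f bij_is_surj)

lemma prod_Basis_cart: "(\<Prod>b\<in>Basis. x \<bullet> b) = (\<Prod>i\<in>UNIV. x $ i)" for x :: "real ^ 'k::finite"
proof -
  have eq: "(Basis :: (real ^ 'k) set) = range (\<lambda>i. axis i 1)"
    by (auto simp: Basis_vec_def)
  show ?thesis
    unfolding eq by (subst prod.reindex) (auto simp: inj_def axis_eq_axis inner_axis)
qed

lemma distr_lborel_reindex:
  fixes f :: "'m::finite \<Rightarrow> 'n::finite"
  assumes f: "bij f"
  shows "distr lborel borel (reindex f) = lborel"
proof (rule lborel_eqI[symmetric])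
  have meas: "reindex f \<in> borel_measurable borel"
    by (intro borel_measurable_continuous_onI linear_continuous_on bounded_linear_reindex)
  fix l u :: "real ^ 'm"
  assume lu: "\<And>b. b \<in> Basis \<Longrightarrow> l \<bullet> b \<le> u \<bullet> b"
  have "reindex f -` box l u = box (reindex (inv f) l) (reindex (inv f) u)"
  proof (intro set_eqI)
    fix x :: "real ^ 'n"
    have "(\<forall>j. P (f j) j) \<longleftrightarrow> (\<forall>i. P i (inv f i))" for P :: "'n \<Rightarrow> 'm \<Rightarrow> bool"
      using f by (metis bij_inv_eq_iff)
    from this[of "\<lambda>i j. l $ j < x $ i \<and> x $ i < u $ j"]
    show "x \<in> reindex f -` box l u \<longleftrightarrow> x \<in> box (reindex (inv f) l) (reindex (inv f) u)"
      by (simp add: mem_box_cart reindex_def)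
  qed
  then have "emeasure (distr lborel borel (reindex f)) (box l u)
      = emeasure lborel (box (reindex (inv f) l) (reindex (inv f) u))"
    by (subst emeasure_distr) (use meas in auto)
  also have "\<dots> = (\<Prod>b\<in>Basis. (reindex (inv f) u - reindex (inv f) l) \<bullet> b)"
  proof (rule emeasure_lborel_box)
    fix b :: "real ^ 'n" assume "b \<in> Basis"
    then obtain i where "b = axis i 1"
      by (auto simp: Basis_vec_def)
    then show "reindex (inv f) l \<bullet> b \<le> reindex (inv f) u \<bullet> b"
      using lu[of "axis (inv f i) 1"] by (simp add: inner_axis reindex_def axis_in_Basis_iff)
  qed
  also have "\<dots> = (\<Prod>b\<in>Basis. (u - l) \<bullet> b)"
    unfolding prod_Basis_cart reindex_def using prod.reindex_bij_betw[OF bij_imp_bij_inv[OF f], of "\<lambda>i. u $ i - l $ i"]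
    by simp
  finally show "emeasure (distr lborel borel (reindex f)) (box l u)
    = ennreal (\<Prod>b\<in>Basis. (u - l) \<bullet> b)" by simp
qed simp

lemma lebesgue_reindex:
  fixes f :: "'m::finite \<Rightarrow> 'n::finite"
  assumes f: "bij f"
  shows measurable_reindex: "reindex f \<in> lebesgue \<rightarrow>\<^sub>M lebesgue"
    and distr_lebesgue_reindex: "distr lebesgue lebesgue (reindex f) = lebesgue"
proof -
  have cont: "reindex f \<in> borel_measurable borel"
    by (intro borel_measurable_continuous_onI linear_continuous_on bounded_linear_reindex)
  have 1: "(reindex f :: real ^ 'n \<Rightarrow> real ^ 'm) \<in> lebesgue \<rightarrow>\<^sub>M lborel"
    using cont by (intro measurable_completion) simp
  have d: "distr lebesgue lborel (reindex f) = lborel"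
  proof -
    have "distr lebesgue lborel (reindex f) = distr lborel lborel (reindex f)"
      using cont by (intro distr_completion) simp
    also have "\<dots> = distr lborel borel (reindex f)"
      by (rule distr_cong) auto
    finally show ?thesis using distr_lborel_reindex[OF f] by simp
  qed
  show m: "reindex f \<in> lebesgue \<rightarrow>\<^sub>M lebesgue"
    using 1 d by (intro completion.measurable_completion2) auto
  show "distr lebesgue lebesgue (reindex f) = lebesgue"
    using completion.completion_distr_eq[OF 1] d by simp
qed

lemma lmeasurable_reindex:
  fixes f :: "'m::finite \<Rightarrow> 'n::finite"
  assumes f: "bij f" and S: "S \<in> lmeasurable"
  shows "reindex f ` S \<in> lmeasurable" and "measure lebesgue (reindex f ` S) = measure lebesgue S"
proof -
  let ?g = "reindex (inv f) :: real ^ 'm \<Rightarrow> real ^ 'n"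
  have g: "bij (inv f)" using f by (rule bij_imp_bij_inv)
  have eq: "reindex f ` S = ?g -` S \<inter> space lebesgue"
  proof (intro set_eqI)
    fix y
    show "y \<in> reindex f ` S \<longleftrightarrow> y \<in> ?g -` S \<inter> space lebesgue"
      using reindex_inverse[OF f] by (simp add: image_iff) metis
  qed
  have sets: "reindex f ` S \<in> sets lebesgue"
    unfolding eq using S measurable_reindex[OF g] by (intro measurable_sets) (auto simp: fmeasurable_def)
  have "emeasure lebesgue S = emeasure (distr lebesgue lebesgue ?g) S"
    by (simp add: distr_lebesgue_reindex[OF g])
  also have "\<dots> = emeasure lebesgue (reindex f ` S)"
    unfolding eq using S measurable_reindex[OF g] by (intro emeasure_distr) (auto simp: fmeasurable_def)
  finally have "emeasure lebesgue (reindex f ` S) = emeasure lebesgue S" by simp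
  with sets S show "reindex f ` S \<in> lmeasurable" "measure lebesgue (reindex f ` S) = measure lebesgue S"
    by (auto simp: fmeasurable_def measure_def)
qed

text \<open>Conjugation with a bijection of the index types maps permutations to permutations of the same sign, so
the Leibniz formulas agree term by term.\<close>

lemma det_reindex:
  fixes A :: "real ^ 'n::finite ^ 'n" and f :: "'m::finite \<Rightarrow> 'n"
  assumes f: "bij f"
  shows "det (\<chi> i j. A $ f i $ f j) = det A"
proof -
  let ?c = "map_permutation (UNIV :: 'm set) f"
  have inj: "inj f" and surj: "f ` UNIV = UNIV"
    using f by (auto simp: bij_is_inj bij_is_surj)
  have inv: "bij_betw (inv f) UNIV UNIV" "inj (inv f)" "\<And>y. f (inv f y) = y" "\<And>x. inv f (f x) = x"
    using bij_imp_bij_inv[OF f] f by (simp_all add: bij_is_inj bij_is_surj surj_f_inv_f)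
  have bij: "bij_betw ?c {p. p permutes UNIV} {p. p permutes UNIV}"
  proof (rule bij_betw_byWitness[where f' = "map_permutation UNIV (inv f)"])
    show "\<forall>p\<in>{p. p permutes UNIV}. map_permutation UNIV (inv f) (?c p) = p"
      using f inv by (auto intro!: map_permutation_compose_inv)
    show "\<forall>p\<in>{p. p permutes UNIV}. ?c (map_permutation UNIV (inv f) p) = p"
      using inv by (auto intro!: map_permutation_compose_inv)
    show "?c ` {p. p permutes UNIV} \<subseteq> {p. p permutes UNIV}"
      using map_permutation_permutes[OF f] by blast
    show "map_permutation UNIV (inv f) ` {p. p permutes UNIV} \<subseteq> {p. p permutes UNIV}"
      using map_permutation_permutes[OF inv(1)] by blast
  qed
  have prod: "(\<Prod>i\<in>UNIV. A $ i $ ?c p i) = (\<Prod>i\<in>UNIV. A $ f i $ f (p i))" for p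
    using prod.reindex_bij_betw[OF f, of "\<lambda>i. A $ i $ ?c p i"]
    by (simp add: map_permutation_apply[OF inj])
  have "det A = (\<Sum>p\<in>{p. p permutes UNIV}. of_int (sign (?c p)) * (\<Prod>i\<in>UNIV. A $ i $ ?c p i))"
    unfolding det_def by (rule sum.reindex_bij_betw[OF bij, symmetric])
  also have "\<dots> = (\<Sum>p\<in>{p. p permutes (UNIV :: 'm set)}. of_int (sign p) * (\<Prod>i\<in>UNIV. A $ f i $ f (p i)))"
    by (rule sum.cong) (simp_all add: prod sign_map_permutation[OF inj])
  finally show ?thesis
    unfolding det_def by simp
qed

lemma measure_image_bounds_wellorder:
  fixes F :: "real ^ 'n::{finite,wellorder} \<Rightarrow> real ^ 'n::_" and H :: "real ^ 'n::_ \<Rightarrow> real ^ 'n::_ ^ 'n::_"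
  assumes S: "S \<in> lmeasurable"
    and der: "\<And>x. x \<in> S \<Longrightarrow> (F has_derivative (*v) (H x)) (at x)"
    and inj: "inj_on F S"
    and cont: "continuous_on S H"
    and bounds: "\<And>x. x \<in> S \<Longrightarrow> a \<le> \<bar>det (H x)\<bar> \<and> \<bar>det (H x)\<bar> \<le> b"
  shows "F ` S \<in> lmeasurable"
    and "a * measure lebesgue S \<le> measure lebesgue (F ` S)"
    and "measure lebesgue (F ` S) \<le> b * measure lebesgue S"
proof -
  have Ssets: "S \<in> sets lebesgue" using S by auto
  have const: "(\<lambda>x. c) integrable_on S" "integral S (\<lambda>x. c) = c * measure lebesgue S" for c :: real
    using S lmeasure_integral[OF S] integral_mult_right[of S c "\<lambda>x. 1"]
    by (simp_all add: integrable_on_const)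
  have "continuous_on S (\<lambda>x. \<bar>det (H x)\<bar>)"
    unfolding det_def using cont by (intro continuous_intros)
  then have "(\<lambda>x. \<bar>det (H x)\<bar>) \<in> borel_measurable (lebesgue_on S)"
    using Ssets by (rule continuous_imp_measurable_on_sets_lebesgue)
  then have int: "(\<lambda>x. \<bar>det (H x)\<bar>) integrable_on S"
    by (rule measurable_bounded_by_integrable_imp_integrable[OF _ const(1)[of b]])
      (use bounds Ssets in auto)
  have *: "F ` S \<in> lmeasurable \<and> measure lebesgue (F ` S) = integral S (\<lambda>x. \<bar>det (H x)\<bar>)"
    using has_measure_differentiable_image[of S F "\<lambda>x. (*v) (H x)"] Ssets der inj int
    by (simp add: has_derivative_at_withinI has_integral_iff)
  then show "F ` S \<in> lmeasurable" by simp
  show "a * measure lebesgue S \<le> measure lebesgue (F ` S)"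
    using integral_le[OF const(1) int, of a] bounds const(2)[of a] * by auto
  show "measure lebesgue (F ` S) \<le> b * measure lebesgue S"
    using integral_le[OF int const(1), of b] bounds const(2)[of b] * by auto
qed

text \<open>The statement of \<open>measure_image_bounds_wellorder\<close> does not refer to the order of the indices; it is
transported along \<open>reindex\<close>.\<close>

lemma measure_image_bounds:
  fixes F :: "real ^ 'n::finite \<Rightarrow> real ^ 'n" and H :: "real ^ 'n \<Rightarrow> real ^ 'n ^ 'n"
  assumes S: "S \<in> lmeasurable"
    and der: "\<And>x. x \<in> S \<Longrightarrow> (F has_derivative (*v) (H x)) (at x)"
    and inj: "inj_on F S"
    and cont: "continuous_on S H"
    and bounds: "\<And>x. x \<in> S \<Longrightarrow> a \<le> \<bar>det (H x)\<bar> \<and> \<bar>det (H x)\<bar> \<le> b"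
  shows "F ` S \<in> lmeasurable"
    and "a * measure lebesgue S \<le> measure lebesgue (F ` S)"
    and "measure lebesgue (F ` S) \<le> b * measure lebesgue S"
proof -
  have bij: "bij (original :: 'n ordered_copy \<Rightarrow> 'n)"
    by (rule bijI') (simp add: original_inject, metis copy_inverse UNIV_I)
  let ?T = "reindex (original :: 'n ordered_copy \<Rightarrow> 'n)"
  let ?R = "reindex (inv (original :: 'n ordered_copy \<Rightarrow> 'n))"
  note inverse = reindex_inverse[OF bij]
  have bl: "bounded_linear ?T" "bounded_linear ?R"
    by (rule bounded_linear_reindex)+
  let ?F = "\<lambda>y. ?T (F (?R y))"
  let ?H = "\<lambda>y. (\<chi> i j. H (?R y) $ original i $ original j) :: real ^ 'n ordered_copy ^ 'n ordered_copy"
  have mult: "?T (H x *v ?R h) = (\<chi> i j. H x $ original i $ original j) *v h" for x h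
    unfolding vec_eq_iff reindex_def matrix_vector_mult_def
    using sum.reindex_bij_betw[OF bij, of "\<lambda>j. H x $ original i $ j * h $ inv original j" for i] bij
    by (auto simp: bij_is_inj)
  have image: "?F ` ?T ` S = ?T ` F ` S"
    by (simp add: image_image inverse)
  have 1: "(?F has_derivative (*v) (?H y)) (at y)" if "y \<in> ?T ` S" for y
  proof -
    have "(F has_derivative (*v) (H (?R y))) (at (?R y))"
      using that der inverse by auto
    from has_derivative_compose[OF bounded_linear_imp_has_derivative[OF bl(2)] this]
    have "((\<lambda>y. F (?R y)) has_derivative (\<lambda>h. H (?R y) *v ?R h)) (at y)" .
    from has_derivative_compose[OF this bounded_linear_imp_has_derivative[OF bl(1)]]
    show ?thesis by (simp add: mult)
  qed
  have 2: "inj_on ?F (?T ` S)"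
    using inj by (intro inj_on_imageI) (simp add: inj_on_def inverse o_def, metis inverse(1))
  have 3: "continuous_on (?T ` S) ?H"
  proof -
    have "continuous_on (?T ` S) (\<lambda>y. H (?R y))"
      by (rule continuous_on_compose2[OF cont linear_continuous_on[OF bl(2)]]) (auto simp: inverse)
    then show ?thesis by (intro continuous_intros)
  qed
  have 4: "a \<le> \<bar>det (?H y)\<bar> \<and> \<bar>det (?H y)\<bar> \<le> b" if "y \<in> ?T ` S" for y
    using that bounds by (auto simp: det_reindex[OF bij] inverse)
  note main = measure_image_bounds_wellorder[where F = ?F and H = ?H and a = a and b = b, OF lmeasurable_reindex(1)[OF bij S] 1 2 3 4]
  have image_back: "?R ` ?T ` F ` S = F ` S"
    by (simp add: image_image inverse)
  have m: "?T ` F ` S \<in> lmeasurable"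
    using main(1) image by simp
  note R = lmeasurable_reindex[OF bij_imp_bij_inv[OF bij] m, unfolded image_back]
  show "F ` S \<in> lmeasurable" by (fact R(1))
  show "a * measure lebesgue S \<le> measure lebesgue (F ` S)"
    "measure lebesgue (F ` S) \<le> b * measure lebesgue S"
    using main(2,3) lmeasurable_reindex(2)[OF bij S] image R(2) by simp_all
qed

section \<open>Positive definite matrices and second-order behaviour\<close>

definition pos_def :: "real ^ 'n ^ 'n::finite \<Rightarrow> bool"
  where "pos_def A \<longleftrightarrow> (\<forall>h. h \<noteq> 0 \<longrightarrow> 0 < h \<bullet> (A *v h))"

lemma continuous_on_det [continuous_intros]:
  fixes A :: "'a::topological_space \<Rightarrow> real ^ 'n ^ 'n::finite"
  assumes "continuous_on S A"
  shows "continuous_on S (\<lambda>x. det (A x))"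
  unfolding det_def using assms by (intro continuous_intros)

text \<open>The segment from the identity to a positive definite matrix consists of positive definite, hence
invertible, matrices, so the determinant keeps its sign along it.\<close>

lemma det_pos_def:
  assumes A: "pos_def A"
  shows "0 < det A"
proof (rule ccontr)
  assume neg: "\<not> 0 < det A"
  let ?A = "\<lambda>t::real. (1 - t) *\<^sub>R mat 1 + t *\<^sub>R A"
  have mult: "?A t *v h = (1 - t) *\<^sub>R h + t *\<^sub>R (A *v h)" for t h
    by (simp add: matrix_vector_mult_add_rdistrib scaleR_matrix_vector_assoc[symmetric])
  have "continuous_on {0..1} (\<lambda>t. det (?A t))"
    by (intro continuous_intros)
  then obtain t where t: "0 \<le> t" "t \<le> 1" and zero: "det (?A t) = 0"
    using IVT2'[of "\<lambda>t. det (?A t)" 1 0 0] neg by auto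
  have "h = 0" if "?A t *v h = 0" for h
  proof (rule ccontr)
    assume "h \<noteq> 0"
    then have h: "0 < h \<bullet> h" "0 < h \<bullet> (A *v h)" using A by (auto simp: pos_def_def)
    have "0 < (1 - t) * (h \<bullet> h) + t * (h \<bullet> (A *v h))"
    proof (cases "t = 0")
      case False
      then show ?thesis using h t by (intro add_nonneg_pos mult_pos_pos mult_nonneg_nonneg) auto
    qed (use h in simp)
    also have "\<dots> = h \<bullet> (?A t *v h)" by (simp add: mult inner_add_right)
    finally show False using that by simp
  qed
  then have "det (?A t) \<noteq> 0"
    using matrix_left_invertible_ker[of "?A t"] invertible_det_nz[of "?A t"] invertible_left_inverse
    by blast
  with zero show False by simp
qed

text \<open>The quadratic form has a positive minimum on the unit sphere, and a small change of the matrix changes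
the form there by less than this minimum.\<close>

lemma eventually_pos_def:
  assumes A: "pos_def A"
  shows "\<exists>e>0. \<forall>B. norm (B - A) < e \<longrightarrow> pos_def B"
proof -
  let ?n = "real CARD('a) * real CARD('a)"
  have bound: "\<bar>h \<bullet> (B *v h)\<bar> \<le> ?n * norm B" if "norm h = 1" for h and B :: "real ^ 'a ^ 'a"
  proof -
    have "\<bar>h \<bullet> (B *v h)\<bar> \<le> norm (B *v h)"
      using Cauchy_Schwarz_ineq2[of h "B *v h"] that by simp
    also have "\<dots> \<le> (\<Sum>i\<in>UNIV. \<bar>(B *v h) $ i\<bar>)" by (rule norm_le_l1_cart)
    also have "\<dots> \<le> (\<Sum>i\<in>(UNIV :: 'a set). real CARD('a) * norm B)"
    proof (rule sum_mono)
      fix i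
      have "\<bar>(B *v h) $ i\<bar> \<le> (\<Sum>j\<in>UNIV. \<bar>B $ i $ j * h $ j\<bar>)"
        unfolding matrix_vector_mult_def by (simp add: sum_abs)
      also have "\<dots> \<le> (\<Sum>j\<in>(UNIV :: 'a set). norm B)"
      proof (rule sum_mono)
        fix j
        have "\<bar>B $ i $ j\<bar> \<le> norm B"
          using component_le_norm_cart[of "B $ i" j] Finite_Cartesian_Product.norm_nth_le[of B i] by linarith
        moreover have "\<bar>h $ j\<bar> \<le> 1" using component_le_norm_cart[of h j] that by simp
        ultimately show "\<bar>B $ i $ j * h $ j\<bar> \<le> norm B"
          unfolding abs_mult using mult_mono[of "\<bar>B $ i $ j\<bar>" "norm B" "\<bar>h $ j\<bar>" 1] by simp
      qed
      finally show "\<bar>(B *v h) $ i\<bar> \<le> real CARD('a) * norm B" by simp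
    qed
    finally show ?thesis by simp
  qed
  have sphere: "sphere 0 1 \<noteq> ({} :: (real ^ 'a) set)"
    by simp
  have "continuous_on (sphere 0 1) (\<lambda>h. h \<bullet> (A *v h))"
    by (intro continuous_intros linear_continuous_on matrix_vector_mul_bounded_linear)
  from continuous_attains_inf[OF compact_sphere sphere this]
  obtain h0 where h0: "norm h0 = 1" and min: "\<And>h. norm h = 1 \<Longrightarrow> h0 \<bullet> (A *v h0) \<le> h \<bullet> (A *v h)"
    by auto
  define m where "m = h0 \<bullet> (A *v h0)"
  have m: "0 < m" using A h0 unfolding m_def pos_def_def by (metis norm_zero zero_neq_one)
  have n: "0 < ?n" by simp
  have "pos_def B" if B: "norm (B - A) < m / ?n" for B
    unfolding pos_def_def
  proof (intro allI impI)
    fix h :: "real ^ 'a" assume "h \<noteq> 0"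
    define k where "k = (1 / norm h) *\<^sub>R h"
    have k: "norm k = 1" "h = norm h *\<^sub>R k" using \<open>h \<noteq> 0\<close> by (simp_all add: k_def)
    have "?n * norm (B - A) < m" using B n by (simp add: field_simps)
    then have "\<bar>k \<bullet> ((B - A) *v k)\<bar> < m" using bound[OF k(1), of "B - A"] by linarith
    moreover have "k \<bullet> (B *v k) = k \<bullet> (A *v k) + k \<bullet> ((B - A) *v k)"
      by (simp add: matrix_vector_mult_diff_rdistrib inner_diff_right)
    ultimately have "0 < k \<bullet> (B *v k)" using min[OF k(1)] unfolding m_def by linarith
    then have "0 < norm h * (norm h * (k \<bullet> (B *v k)))" using \<open>h \<noteq> 0\<close> by simp
    also have "\<dots> = h \<bullet> (B *v h)"
      by (subst (3 4) k(2)) (simp add: matrix_vector_mult_scaleR)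
    finally show "0 < h \<bullet> (B *v h)" .
  qed
  then show ?thesis using m n by (intro exI[of _ "m / ?n"]) simp
qed

lemma gradient_strictly_monotone:
  fixes G :: "real ^ 'n::finite \<Rightarrow> real ^ 'n"
  assumes der: "\<And>\<xi>. \<xi> \<in> closed_segment y z \<Longrightarrow> (G has_derivative (*v) (H \<xi>)) (at \<xi>)"
    and pos: "\<And>\<xi>. \<xi> \<in> closed_segment y z \<Longrightarrow> 0 < (z - y) \<bullet> (H \<xi> *v (z - y))"
  shows "0 < (G z - G y) \<bullet> (z - y)"
proof -
  let ?p = "\<lambda>t::real. y + t *\<^sub>R (z - y)"
  let ?g = "\<lambda>t. G (?p t) \<bullet> (z - y)"
  have "\<exists>d. DERIV ?g t :> d \<and> 0 < d" if "0 \<le> t" "t \<le> 1" for t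
  proof -
    have seg: "?p t \<in> closed_segment y z"
      using that unfolding in_segment by (intro exI[of _ t]) (simp add: algebra_simps)
    have "(?p has_derivative (\<lambda>s. s *\<^sub>R (z - y))) (at t)"
      by (auto intro!: derivative_eq_intros)
    from has_derivative_compose[OF this der[OF seg]]
    have "(?g has_derivative (\<lambda>s. (H (?p t) *v (s *\<^sub>R (z - y))) \<bullet> (z - y))) (at t)"
      by (rule has_derivative_inner_left)
    then have "DERIV ?g t :> (z - y) \<bullet> (H (?p t) *v (z - y))"
      unfolding has_field_derivative_def
      by (rule has_derivative_eq_rhs) (simp add: fun_eq_iff matrix_vector_mult_scaleR inner_commute)
    with pos[OF seg] show ?thesis by blast
  qed
  then have "?g 0 < ?g 1"
    by (rule DERIV_pos_imp_increasing[where f = ?g, OF zero_less_one])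
  then show ?thesis by (simp add: inner_diff_left)
qed

lemma strictly_above_tangent:
  fixes G :: "real ^ 'n::finite \<Rightarrow> real ^ 'n"
  assumes \<phi>: "\<And>\<xi>. \<xi> \<in> closed_segment y z \<Longrightarrow> (\<phi> has_derivative (\<lambda>h. G \<xi> \<bullet> h)) (at \<xi>)"
    and der: "\<And>\<xi>. \<xi> \<in> closed_segment y z \<Longrightarrow> (G has_derivative (*v) (H \<xi>)) (at \<xi>)"
    and pos: "\<And>\<xi>. \<xi> \<in> closed_segment y z \<Longrightarrow> 0 < (z - y) \<bullet> (H \<xi> *v (z - y))"
  shows "\<phi> y + G y \<bullet> (z - y) < \<phi> z"
proof -
  let ?p = "\<lambda>t::real. y + t *\<^sub>R (z - y)"
  let ?g = "\<lambda>t. \<phi> (?p t) - t * (G y \<bullet> (z - y))"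
  have seg: "?p t \<in> closed_segment y z" if "0 \<le> t" "t \<le> 1" for t
    using that unfolding in_segment by (intro exI[of _ t]) (simp add: algebra_simps)
  have deriv: "DERIV ?g t :> (G (?p t) - G y) \<bullet> (z - y)" if "0 \<le> t" "t \<le> 1" for t
  proof -
    have "(?p has_derivative (\<lambda>s. s *\<^sub>R (z - y))) (at t)"
      by (auto intro!: derivative_eq_intros)
    from has_derivative_compose[OF this \<phi>[OF seg[OF that]]]
    have "((\<lambda>t. \<phi> (?p t)) has_derivative (\<lambda>s. G (?p t) \<bullet> (s *\<^sub>R (z - y)))) (at t)" .
    then have "DERIV (\<lambda>t. \<phi> (?p t)) t :> G (?p t) \<bullet> (z - y)"
      unfolding has_field_derivative_def
      by (rule has_derivative_eq_rhs) (simp add: fun_eq_iff)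
    from DERIV_diff[OF this DERIV_cmult_right[OF DERIV_ident]]
    show ?thesis by (simp add: inner_diff_left)
  qed
  have pos': "0 < (G (?p t) - G y) \<bullet> (z - y)" if "0 < t" "t < 1" for t
  proof -
    have sub: "closed_segment y (?p t) \<subseteq> closed_segment y z"
      using seg[of t] that by (intro closed_segment_subset convex_closed_segment) auto
    have "0 < (G (?p t) - G y) \<bullet> (?p t - y)"
    proof (rule gradient_strictly_monotone)
      fix \<xi> assume "\<xi> \<in> closed_segment y (?p t)"
      then have \<xi>: "\<xi> \<in> closed_segment y z" using sub by blast
      show "(G has_derivative (*v) (H \<xi>)) (at \<xi>)" by (rule der[OF \<xi>])
      show "0 < (?p t - y) \<bullet> (H \<xi> *v (?p t - y))"
        using pos[OF \<xi>] that by (simp add: matrix_vector_mult_scaleR)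
    qed
    then show ?thesis using that by (simp add: zero_less_mult_iff)
  qed
  have "?g 0 < ?g 1"
  proof (rule DERIV_pos_imp_increasing_open[where f = ?g, OF zero_less_one])
    fix t :: real assume "0 < t" "t < 1"
    then have "DERIV ?g t :> (G (?p t) - G y) \<bullet> (z - y)" "0 < (G (?p t) - G y) \<bullet> (z - y)"
      by (simp_all add: deriv pos')
    then show "\<exists>d. DERIV ?g t :> d \<and> 0 < d"
      by blast
  next
    show "continuous_on {0..1} ?g"
      by (intro continuous_at_imp_continuous_on ballI, rule DERIV_isCont, rule deriv) auto
  qed
  then show ?thesis by simp
qed

text \<open>If the Hessian were negative in some direction, then \<open>\<phi>\<close>, and with it \<open>u\<close>, would violate the midpoint
inequality on a short segment in this direction centred at the contact point.\<close>

lemma convex_touching_above_semidefinite: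
  fixes u :: "real ^ 'n::finite \<Rightarrow> real"
  assumes u: "convex_on \<Omega> u" and \<Omega>: "open U" "U \<subseteq> \<Omega>" "x \<in> U"
    and \<phi>: "\<And>y. y \<in> U \<Longrightarrow> (\<phi> has_derivative (\<lambda>h. G y \<bullet> h)) (at y)"
    and G: "\<And>y. y \<in> U \<Longrightarrow> (G has_derivative (*v) (H y)) (at y)"
    and H: "continuous_on U H"
    and touch: "\<And>y. y \<in> U \<Longrightarrow> u y - \<phi> y \<le> u x - \<phi> x"
  shows "0 \<le> h \<bullet> (H x *v h)"
proof (rule ccontr)
  assume neg: "\<not> 0 \<le> h \<bullet> (H x *v h)"
  have "continuous_on U (\<lambda>y. h \<bullet> (H y *v h))"
    unfolding matrix_vector_mult_def inner_vec_def by (intro continuous_intros H)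
  then have "open (U \<inter> (\<lambda>y. h \<bullet> (H y *v h)) -` {..<0})"
    using \<Omega>(1) by (rule continuous_open_preimage) simp
  then have "\<exists>e>0. ball x e \<subseteq> U \<inter> (\<lambda>y. h \<bullet> (H y *v h)) -` {..<0}"
    using neg \<Omega>(3) unfolding open_contains_ball by simp
  then obtain e where e: "0 < e" and ball: "ball x e \<subseteq> {y \<in> U. h \<bullet> (H y *v h) < 0}"
    by auto
  have "h \<noteq> 0" using neg by auto
  define k where "k = (e / (2 * norm h)) *\<^sub>R h"
  have k: "norm k < e" using \<open>h \<noteq> 0\<close> e by (simp add: k_def)
  have scaled: "s *\<^sub>R k \<bullet> (H y *v (s *\<^sub>R k)) < 0" if "y \<in> ball x e" "s \<noteq> 0" for s y
  proof -
    have "s *\<^sub>R k \<bullet> (H y *v (s *\<^sub>R k)) = (s * (e / (2 * norm h)))\<^sup>2 * (h \<bullet> (H y *v h))"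
      by (simp add: k_def matrix_vector_mult_scaleR power2_eq_square)
    then show ?thesis
      using ball that e \<open>h \<noteq> 0\<close> by (auto simp: mult_less_0_iff zero_less_power2)
  qed
  (* Both end points of the segment lie strictly below the tangent plane at its centre. *)
  have below: "\<phi> (x + s *\<^sub>R k) < \<phi> x + s * (G x \<bullet> k)" if s: "\<bar>s\<bar> = 1" for s
  proof -
    have "x + s *\<^sub>R k \<in> ball x e" using k s by (simp add: dist_norm)
    then have seg: "closed_segment x (x + s *\<^sub>R k) \<subseteq> ball x e"
      using e by (intro closed_segment_subset) auto
    have "- \<phi> x + (- G x) \<bullet> (x + s *\<^sub>R k - x) < - \<phi> (x + s *\<^sub>R k)"
    proof (rule strictly_above_tangent[where H = "\<lambda>y. - H y" and G = "\<lambda>y. - G y" and \<phi> = "\<lambda>y. - \<phi> y"])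
      fix \<xi> assume "\<xi> \<in> closed_segment x (x + s *\<^sub>R k)"
      then have \<xi>: "\<xi> \<in> ball x e" "\<xi> \<in> U" using seg ball by auto
      show "((\<lambda>y. - \<phi> y) has_derivative (\<lambda>h. - G \<xi> \<bullet> h)) (at \<xi>)"
        using has_derivative_minus[OF \<phi>[OF \<xi>(2)]] by simp
      have m: "(- A) *v v = - (A *v v)" for A :: "real ^ 'n ^ 'n" and v
        by (simp add: matrix_vector_mult_def vec_eq_iff sum_negf)
      show "((\<lambda>y. - G y) has_derivative (*v) (- H \<xi>)) (at \<xi>)"
        using has_derivative_minus[OF G[OF \<xi>(2)]] by (rule has_derivative_eq_rhs) (simp add: m fun_eq_iff)
      show "0 < (x + s *\<^sub>R k - x) \<bullet> (- H \<xi> *v (x + s *\<^sub>R k - x))"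
        using scaled[OF \<xi>(1), of s] s by (auto simp: m)
    qed
    then show ?thesis by simp
  qed
  have "x + k \<in> ball x e" "x - k \<in> ball x e" using k by (simp_all add: dist_norm)
  then have U: "x + k \<in> U" "x - k \<in> U" using ball by blast+
  have "u ((1 - 1/2) *\<^sub>R (x + k) + (1/2) *\<^sub>R (x - k)) \<le> (1 - 1/2) * u (x + k) + (1/2) * u (x - k)"
    using U \<Omega>(2) by (intro convex_onD[OF u]) auto
  moreover have "(1 - 1/2) *\<^sub>R (x + k) + (1/2) *\<^sub>R (x - k) = x"
    by (simp add: vec_eq_iff field_simps)
  ultimately show False
    using below[of 1] below[of "-1"] touch[OF U(1)] touch[OF U(2)] by simp
qed

section \<open>Alexandrov solutions are viscosity solutions\<close>

text \<open>\<open>measure_of\<close> yields the null measure when the given set function is not a measure, so the equation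
between the two measures reveals the size of the subdifferential image only for sets to which the
density gives positive mass. Such a set also rules out the degenerate case.\<close>

lemma emeasure_subdifferential_image:
  fixes u :: "'a::euclidean_space \<Rightarrow> real"
  assumes u: "alexandrov_solution \<Omega> f u" and \<Omega>: "open \<Omega>" and f: "continuous_on \<Omega> f"
    and N: "open N" "N \<subseteq> \<Omega>" and pos: "(\<integral>\<^sup>+x\<in>N. ennreal (f x) \<partial>lborel) \<noteq> 0"
  shows "emeasure lebesgue (\<Union>x\<in>N. subdifferential \<Omega> u x) = (\<integral>\<^sup>+x\<in>N. ennreal (f x) \<partial>lborel)"
proof -
  let ?M = "monge_ampere_measure \<Omega> u"
  have sets: "N \<in> sets (restrict_space borel \<Omega>)"
    using N \<Omega> by (simp add: sets_restrict_space_iff)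
  have meas: "(\<lambda>x. ennreal (f x)) \<in> borel_measurable (restrict_space lborel \<Omega>)"
  proof -
    have "sets (restrict_space lborel \<Omega>) = sets (restrict_space borel \<Omega>)"
      by (simp add: sets_restrict_space)
    then have "f \<in> borel_measurable (restrict_space lborel \<Omega>)"
      using borel_measurable_continuous_on_restrict[OF f] measurable_cong_sets[OF _ refl] by blast
    then show ?thesis by (rule measurable_compose[OF _ measurable_ennreal])
  qed
  have "emeasure ?M N = emeasure (density (restrict_space lborel \<Omega>) (\<lambda>x. ennreal (f x))) N"
    using u by (simp add: alexandrov_solution_def)
  also have "\<dots> = (\<integral>\<^sup>+x. ennreal (f x) * indicator N x \<partial>restrict_space lborel \<Omega>)"
    using meas sets by (intro emeasure_density) (simp_all add: sets_restrict_space)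
  also have "\<dots> = (\<integral>\<^sup>+x. ennreal (f x) * indicator N x * indicator \<Omega> x \<partial>lborel)"
    using \<Omega> by (intro nn_integral_restrict_space) simp
  also have "\<dots> = (\<integral>\<^sup>+x\<in>N. ennreal (f x) \<partial>lborel)"
    using N(2) by (intro nn_integral_cong) (auto simp: indicator_def)
  finally have eq: "emeasure ?M N = (\<integral>\<^sup>+x\<in>N. ennreal (f x) \<partial>lborel)" .
  moreover have "emeasure ?M N = emeasure lebesgue (\<Union>x\<in>N. subdifferential \<Omega> u x)"
    using pos eq unfolding monge_ampere_measure_def emeasure_measure_of_conv
    by (auto split: if_splits)
  ultimately show ?thesis by simp
qed

lemma measure_open_pos:
  fixes N :: "'a::euclidean_space set"
  assumes "open N" "bounded N" "N \<noteq> {}"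
  shows "N \<in> lmeasurable" and "0 < measure lebesgue N"
proof -
  show lm: "N \<in> lmeasurable" using assms by (simp add: lmeasurable_open)
  then have "measure lebesgue N \<noteq> 0"
    using open_not_negligible[OF assms(1,3)] by (simp add: negligible_iff_measure)
  then show "0 < measure lebesgue N" by (simp add: measure_nonneg less_le)
qed

lemma subdifferential_image_bounds:
  fixes u :: "'a::euclidean_space \<Rightarrow> real"
  assumes u: "alexandrov_solution \<Omega> f u" and \<Omega>: "open \<Omega>" and f: "continuous_on \<Omega> f"
    and N: "open N" "bounded N" "N \<noteq> {}" "N \<subseteq> \<Omega>"
    and bounds: "0 < a" "\<And>x. x \<in> N \<Longrightarrow> a \<le> f x \<and> f x \<le> b"
  shows "(\<Union>x\<in>N. subdifferential \<Omega> u x) \<in> lmeasurable"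
    and "a * measure lebesgue N \<le> measure lebesgue (\<Union>x\<in>N. subdifferential \<Omega> u x)"
    and "measure lebesgue (\<Union>x\<in>N. subdifferential \<Omega> u x) \<le> b * measure lebesgue N"
proof -
  let ?D = "\<Union>x\<in>N. subdifferential \<Omega> u x" and ?I = "\<integral>\<^sup>+x\<in>N. ennreal (f x) \<partial>lborel"
  note lm = measure_open_pos(1)[OF N(1-3)] and pos = measure_open_pos(2)[OF N(1-3)]
  have m: "emeasure lborel N = ennreal (measure lebesgue N)"
    using N(1) lm emeasure_eq_measure2[of N lebesgue] by simp
  have b: "0 < b" using N(3) bounds by force
  have const: "(\<integral>\<^sup>+x\<in>N. ennreal c \<partial>lborel) = ennreal (c * measure lebesgue N)" if "0 < c" for c
    using that N(1) by (simp add: nn_integral_cmult_indicator m ennreal_mult)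
  have lower: "ennreal (a * measure lebesgue N) \<le> ?I"
    unfolding const[OF bounds(1), symmetric] using bounds(2)
    by (intro nn_integral_mono) (auto simp: indicator_def ennreal_leI)
  have upper: "?I \<le> ennreal (b * measure lebesgue N)"
    unfolding const[OF b, symmetric] using bounds(2)
    by (intro nn_integral_mono) (auto simp: indicator_def ennreal_leI)
  have "?I \<noteq> 0" using lower pos bounds(1) by auto
  with emeasure_subdifferential_image[OF u \<Omega> f N(1,4)]
  have eq: "emeasure lebesgue ?D = ?I" by simp
  with \<open>?I \<noteq> 0\<close> have "?D \<in> sets lebesgue" using emeasure_notin_sets by metis
  moreover have "emeasure lebesgue ?D < \<infinity>" using upper eq by (simp add: le_less_trans)
  ultimately show D: "?D \<in> lmeasurable" by (simp add: fmeasurable_def)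
  then have "emeasure lebesgue ?D = ennreal (measure lebesgue ?D)"
    by (simp add: emeasure_eq_measure2)
  then have "ennreal (a * measure lebesgue N) \<le> ennreal (measure lebesgue ?D)"
    "ennreal (measure lebesgue ?D) \<le> ennreal (b * measure lebesgue N)"
    using eq lower upper by simp_all
  then show "a * measure lebesgue N \<le> measure lebesgue ?D"
    "measure lebesgue ?D \<le> b * measure lebesgue N"
    using b by (simp_all add: ennreal_le_iff)
qed

lemma open_strict_sublevel:
  assumes "open U" "continuous_on U f" "continuous_on U g"
  shows "open {y \<in> U. f y < (g y :: real)}"
proof -
  have "open (U \<inter> (\<lambda>y. f y - g y) -` {..<0})"
    using assms by (intro continuous_open_preimage continuous_on_diff) auto
  also have "U \<inter> (\<lambda>y. f y - g y) -` {..<0} = {y \<in> U. f y < g y}" by auto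
  finally show ?thesis .
qed

lemma inj_on_gradient:
  fixes G :: "real ^ 'n::finite \<Rightarrow> real ^ 'n"
  assumes S: "convex S"
    and G: "\<And>y. y \<in> S \<Longrightarrow> (G has_derivative (*v) (H y)) (at y)"
    and H: "\<And>y. y \<in> S \<Longrightarrow> pos_def (H y)"
  shows "inj_on G S"
proof (rule inj_onI, rule ccontr)
  fix y z assume yz: "y \<in> S" "z \<in> S" "G y = G z" "y \<noteq> z"
  then have seg: "closed_segment y z \<subseteq> S"
    using S by (simp add: closed_segment_subset)
  have "0 < (G z - G y) \<bullet> (z - y)"
  proof (rule gradient_strictly_monotone)
    fix \<xi> assume "\<xi> \<in> closed_segment y z"
    then have \<xi>: "\<xi> \<in> S" using seg by blast
    show "(G has_derivative (*v) (H \<xi>)) (at \<xi>)" by (rule G[OF \<xi>])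
    show "0 < (z - y) \<bullet> (H \<xi> *v (z - y))"
      using H[OF \<xi>] yz by (simp add: pos_def_def)
  qed
  with yz show False by simp
qed

text \<open>Let \<open>N\<close> be the part of the ball where \<open>u\<close> exceeds \<open>\<phi>\<close>. A supporting plane of \<open>u\<close> at a point of \<open>N\<close> can be
moved down until it touches the graph of \<open>\<phi>\<close> from below, which happens over \<open>N\<close>; therefore the subdifferential image of
\<open>N\<close> lies in the gradient image of \<open>\<phi>\<close>. The first has measure at least \<open>b \<bar>N\<bar>\<close> and the second at most
\<open>a \<bar>N\<bar>\<close>, which is less.\<close>

lemma no_strict_supersolution_crossing:
  fixes u :: "real ^ 'n::finite \<Rightarrow> real"
  assumes u: "alexandrov_solution \<Omega> f u" and \<Omega>: "open \<Omega>" and f: "continuous_on \<Omega> f"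
    and \<rho>: "0 < \<rho>" "cball q \<rho> \<subseteq> \<Omega>"
    and \<phi>: "\<And>y. y \<in> cball q \<rho> \<Longrightarrow> (\<phi> has_derivative (\<lambda>h. G y \<bullet> h)) (at y)"
    and G: "\<And>y. y \<in> cball q \<rho> \<Longrightarrow> (G has_derivative (*v) (H y)) (at y)"
    and H: "continuous_on (cball q \<rho>) H" "\<And>y. y \<in> cball q \<rho> \<Longrightarrow> pos_def (H y)"
    and det: "\<And>y. y \<in> cball q \<rho> \<Longrightarrow> det (H y) \<le> a" "a < b" "\<And>y. y \<in> cball q \<rho> \<Longrightarrow> b \<le> f y"
    and sphere: "\<And>y. y \<in> sphere q \<rho> \<Longrightarrow> u y < \<phi> y"
  shows "u q \<le> \<phi> q"
proof (rule ccontr)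
  assume q: "\<not> u q \<le> \<phi> q"
  define N where "N = {y \<in> ball q \<rho>. \<phi> y < u y}"
  have ball: "ball q \<rho> \<subseteq> cball q \<rho>" by auto
  have nonempty: "cball q \<rho> \<noteq> {}" using \<rho>(1) by simp
  have cont_u: "continuous_on \<Omega> u"
    using u \<Omega> by (simp add: alexandrov_solution_def convex_on_continuous)
  have cont_\<phi>: "continuous_on (cball q \<rho>) \<phi>"
    using has_derivative_continuous[OF \<phi>] by (intro continuous_at_imp_continuous_on) auto
  have "continuous_on (ball q \<rho>) \<phi>" "continuous_on (ball q \<rho>) u"
    using continuous_on_subset[OF cont_\<phi> ball] continuous_on_subset[OF cont_u order_trans[OF ball \<rho>(2)]] .
  then have open_N: "open N"
    unfolding N_def by (intro open_strict_sublevel open_ball)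
  have N: "q \<in> N" "N \<subseteq> ball q \<rho>" "N \<subseteq> cball q \<rho>" "N \<subseteq> \<Omega>" "bounded N"
    using \<rho> q ball by (auto simp: N_def intro: bounded_subset[OF bounded_ball])
  have inner_deriv: "((\<lambda>y. p \<bullet> y) has_derivative (\<lambda>h. p \<bullet> h)) (at y)" for p y :: "real ^ 'n"
    by (auto intro!: derivative_eq_intros)
  have sub: "(\<Union>x\<in>N. subdifferential \<Omega> u x) \<subseteq> G ` N"
  proof clarify
    fix x p assume x: "x \<in> N" and p: "p \<in> subdifferential \<Omega> u x"
    have "continuous_on (cball q \<rho>) (\<lambda>y. \<phi> y - p \<bullet> y)"
      using cont_\<phi> by (intro continuous_intros)
    from continuous_attains_inf[OF compact_cball nonempty this] obtain y where y: "y \<in> cball q \<rho>"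
      and min: "\<And>z. z \<in> cball q \<rho> \<Longrightarrow> \<phi> y - p \<bullet> y \<le> \<phi> z - p \<bullet> z"
      by blast
    have "y \<in> N"
    proof (rule ccontr)
      assume "y \<notin> N"
      then have "u y \<le> \<phi> y"
        using y sphere[of y] by (cases "y \<in> ball q \<rho>") (auto simp: N_def)
      moreover have "u x + p \<bullet> (y - x) \<le> u y"
        using p y \<rho>(2) by (auto simp: subdifferential_def)
      moreover have "\<phi> y - p \<bullet> y \<le> \<phi> x - p \<bullet> x" using min x N(3) by auto
      moreover have "\<phi> x < u x" using x by (simp add: N_def)
      ultimately show False by (simp add: inner_diff_right)
    qed
    have "((\<lambda>z. \<phi> z - p \<bullet> z) has_derivative (\<lambda>h. G y \<bullet> h - p \<bullet> h)) (at y)"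
      by (intro has_derivative_diff \<phi> y inner_deriv)
    (* The minimum is attained inside the ball, so the gradient of \<phi> equals p there. *)
    then have "(\<lambda>h. G y \<bullet> h - p \<bullet> h) = (\<lambda>h. 0)"
      using min N \<open>y \<in> N\<close> open_N by (intro differential_zero_maxmin[of y N]) auto
    then have "(G y - p) \<bullet> (G y - p) = 0"
      by (metis inner_diff_left)
    then have "p = G y" by simp
    with \<open>y \<in> N\<close> show "p \<in> G ` N" by blast
  qed
  have inj: "inj_on G N"
    using inj_on_subset[OF inj_on_gradient[OF convex_cball G H(2)] N(3)] by simp
  have "N \<noteq> {}" using N(1) by blast
  note lm = measure_open_pos(1)[OF open_N N(5) this] and pos = measure_open_pos(2)[OF open_N N(5) this]
  have derN: "(G has_derivative (*v) (H y)) (at y)" if "y \<in> N" for y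
    using G that N(3) by blast
  have detN: "0 \<le> \<bar>det (H y)\<bar> \<and> \<bar>det (H y)\<bar> \<le> a" if "y \<in> N" for y
    using det(1) det_pos_def[OF H(2)] that N(3) by fastforce
  note image = measure_image_bounds[OF lm derN inj continuous_on_subset[OF H(1) N(3)] detN]
  have bpos: "0 < b" using detN[OF N(1)] det(2) by linarith
  have "compact (cball q \<rho>)" by simp
  then obtain B where B: "\<And>y. y \<in> cball q \<rho> \<Longrightarrow> f y \<le> B"
    using compact_continuous_image[OF continuous_on_subset[OF f \<rho>(2)]] compact_imp_bounded
      bounded_imp_bdd_above unfolding bdd_above_def by (metis imageI)
  have "b \<le> f y \<and> f y \<le> B" if "y \<in> N" for y
    using det(3) B N(3) that by blast
  note D = subdifferential_image_bounds(1,2)[OF u \<Omega> f open_N N(5) \<open>N \<noteq> {}\<close> N(4) bpos this]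
  have "b * measure lebesgue N \<le> a * measure lebesgue N"
    using D(2) measure_mono_fmeasurable[OF sub _ image(1)] D(1) image(3) by auto
  with pos det(2) show False by simp
qed

text \<open>The roles are exchanged: tangent planes of the convex function \<open>\<phi>\<close> over \<open>N = {u < \<phi>}\<close> are moved down until they
touch the graph of \<open>u\<close>, and a plane that supports the convex function \<open>u\<close> locally supports it globally.\<close>

lemma no_strict_subsolution_crossing:
  fixes u :: "real ^ 'n::finite \<Rightarrow> real"
  assumes u: "alexandrov_solution \<Omega> f u" and \<Omega>: "open \<Omega>" and f: "continuous_on \<Omega> f"
    and \<rho>: "0 < \<rho>" "cball q \<rho> \<subseteq> \<Omega>"
    and \<phi>: "\<And>y. y \<in> cball q \<rho> \<Longrightarrow> (\<phi> has_derivative (\<lambda>h. G y \<bullet> h)) (at y)"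
    and G: "\<And>y. y \<in> cball q \<rho> \<Longrightarrow> (G has_derivative (*v) (H y)) (at y)"
    and H: "continuous_on (cball q \<rho>) H" "\<And>y. y \<in> cball q \<rho> \<Longrightarrow> pos_def (H y)"
    and det: "\<And>y. y \<in> cball q \<rho> \<Longrightarrow> f y \<le> a" "a < b" "\<And>y. y \<in> cball q \<rho> \<Longrightarrow> b \<le> det (H y)"
    and f_pos: "\<And>y. y \<in> \<Omega> \<Longrightarrow> 0 < f y"
    and sphere: "\<And>y. y \<in> sphere q \<rho> \<Longrightarrow> \<phi> y < u y"
  shows "\<phi> q \<le> u q"
proof (rule ccontr)
  assume q: "\<not> \<phi> q \<le> u q"
  define N where "N = {y \<in> ball q \<rho>. u y < \<phi> y}"
  have ball: "ball q \<rho> \<subseteq> cball q \<rho>" by auto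
  have nonempty: "cball q \<rho> \<noteq> {}" using \<rho>(1) by simp
  have convex: "convex_on \<Omega> u" using u by (simp add: alexandrov_solution_def)
  have cont_u: "continuous_on \<Omega> u" using convex \<Omega> by (simp add: convex_on_continuous)
  have cont_\<phi>: "continuous_on (cball q \<rho>) \<phi>"
    using has_derivative_continuous[OF \<phi>] by (intro continuous_at_imp_continuous_on) auto
  have "continuous_on (ball q \<rho>) \<phi>" "continuous_on (ball q \<rho>) u"
    using continuous_on_subset[OF cont_\<phi> ball] continuous_on_subset[OF cont_u order_trans[OF ball \<rho>(2)]] .
  then have open_N: "open N"
    unfolding N_def by (intro open_strict_sublevel open_ball)
  have N: "q \<in> N" "N \<subseteq> ball q \<rho>" "N \<subseteq> cball q \<rho>" "N \<subseteq> \<Omega>" "bounded N"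
    using \<rho> q ball by (auto simp: N_def intro: bounded_subset[OF bounded_ball])
  have seg: "closed_segment y z \<subseteq> cball q \<rho>" if "y \<in> cball q \<rho>" "z \<in> cball q \<rho>" for y z
    using that by (intro closed_segment_subset) auto
  have sub: "G ` N \<subseteq> (\<Union>x\<in>N. subdifferential \<Omega> u x)"
  proof clarify
    fix y assume y: "y \<in> N"
    define p where "p = G y"
    have "continuous_on (cball q \<rho>) (\<lambda>z. u z - p \<bullet> z)"
      using continuous_on_subset[OF cont_u \<rho>(2)] by (intro continuous_intros)
    from continuous_attains_inf[OF compact_cball nonempty this] obtain z where z: "z \<in> cball q \<rho>"
      and min: "\<And>w. w \<in> cball q \<rho> \<Longrightarrow> u z - p \<bullet> z \<le> u w - p \<bullet> w"
      by blast
    have "z \<in> N"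
    proof (rule ccontr)
      assume "z \<notin> N"
      then have "\<phi> z \<le> u z"
        using z sphere[of z] by (cases "z \<in> ball q \<rho>") (auto simp: N_def)
      moreover have "y \<noteq> z" using y \<open>z \<notin> N\<close> by blast
      have "\<phi> y + p \<bullet> (z - y) < \<phi> z"
        unfolding p_def
      proof (rule strictly_above_tangent[where H = H])
        fix \<xi> assume "\<xi> \<in> closed_segment y z"
        then have \<xi>: "\<xi> \<in> cball q \<rho>" using seg[of y z] y z N(3) by blast
        show "(\<phi> has_derivative (\<lambda>h. G \<xi> \<bullet> h)) (at \<xi>)" by (rule \<phi>[OF \<xi>])
        show "(G has_derivative (*v) (H \<xi>)) (at \<xi>)" by (rule G[OF \<xi>])
        show "0 < (z - y) \<bullet> (H \<xi> *v (z - y))"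
          using H(2)[OF \<xi>] \<open>y \<noteq> z\<close> by (simp add: pos_def_def)
      qed
      moreover have "u z - p \<bullet> z \<le> u y - p \<bullet> y" using min y N(3) by auto
      moreover have "u y < \<phi> y" using y by (simp add: N_def)
      ultimately show False by (simp add: inner_diff_right)
    qed
    obtain e where e: "0 < e" "ball z e \<subseteq> N"
      using open_N \<open>z \<in> N\<close> unfolding open_contains_ball by blast
    have convex': "convex_on \<Omega> (\<lambda>w. u w - p \<bullet> w)"
    proof (rule convex_onI)
      fix t :: real and y z assume "0 < t" "t < 1" "y \<in> \<Omega>" "z \<in> \<Omega>"
      then show "u ((1 - t) *\<^sub>R y + t *\<^sub>R z) - p \<bullet> ((1 - t) *\<^sub>R y + t *\<^sub>R z)
          \<le> (1 - t) * (u y - p \<bullet> y) + t * (u z - p \<bullet> z)"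
        using convex_onD[OF convex, of t y z] by (simp add: inner_add_right algebra_simps)
    qed (rule convex_on_imp_convex[OF convex])
    have "\<forall>w\<in>\<Omega>. u z - p \<bullet> z \<le> u w - p \<bullet> w"
      using e N min by (intro convex_local_global_minimum[OF e(1) convex']) auto
    then have "p \<in> subdifferential \<Omega> u z"
      by (auto simp: subdifferential_def inner_diff_right algebra_simps)
    with \<open>z \<in> N\<close> show "G y \<in> (\<Union>x\<in>N. subdifferential \<Omega> u x)" unfolding p_def by blast
  qed
  have inj: "inj_on G N"
    using inj_on_subset[OF inj_on_gradient[OF convex_cball G H(2)] N(3)] by simp
  have "N \<noteq> {}" using N(1) by blast
  note lm = measure_open_pos(1)[OF open_N N(5) this] and pos = measure_open_pos(2)[OF open_N N(5) this]
  have derN: "(G has_derivative (*v) (H y)) (at y)" if "y \<in> N" for y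
    using G that N(3) by blast
  have comp: "compact (cball q \<rho>)" by simp
  have "continuous_on (cball q \<rho>) (\<lambda>y. \<bar>det (H y)\<bar>)"
    by (intro continuous_intros H)
  from compact_imp_bounded[OF compact_continuous_image[OF this comp]]
  obtain B where B: "\<And>y. y \<in> cball q \<rho> \<Longrightarrow> \<bar>det (H y)\<bar> \<le> B"
    using bounded_imp_bdd_above unfolding bdd_above_def by (metis imageI)
  have detN: "b \<le> \<bar>det (H y)\<bar> \<and> \<bar>det (H y)\<bar> \<le> B" if "y \<in> N" for y
    using det(3)[of y] B[of y] that N(3) by auto
  note image = measure_image_bounds[OF lm derN inj continuous_on_subset[OF H(1) N(3)] detN]
  from continuous_attains_inf[OF comp nonempty continuous_on_subset[OF f \<rho>(2)]]
  obtain z where z: "z \<in> cball q \<rho>" "\<And>y. y \<in> cball q \<rho> \<Longrightarrow> f z \<le> f y" by auto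
  have fz: "0 < f z" using f_pos z(1) \<rho>(2) by blast
  have "f z \<le> f y \<and> f y \<le> a" if "y \<in> N" for y
    using det(1) z(2) N(3) that by blast
  note D = subdifferential_image_bounds(1,3)[OF u \<Omega> f open_N N(5) \<open>N \<noteq> {}\<close> N(4) fz this]
  have "b * measure lebesgue N \<le> a * measure lebesgue N"
    using D(2) measure_mono_fmeasurable[OF sub _ D(1)] image(1,2) by auto
  with pos det(2) show False by simp
qed

lemma tendsto_det [tendsto_intros]:
  fixes A :: "'a \<Rightarrow> real ^ 'n ^ 'n::finite"
  assumes "(A \<longlongrightarrow> B) F"
  shows "((\<lambda>x. det (A x)) \<longlongrightarrow> det B) F"
  unfolding det_def using assms by (intro tendsto_intros)

lemma quadratic_perturbation:
  fixes \<phi> :: "real ^ 'n::finite \<Rightarrow> real"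
  shows "(\<phi> has_derivative (\<lambda>h. G y \<bullet> h)) (at y) \<Longrightarrow>
      ((\<lambda>y. \<phi> y + \<delta> * ((y - x) \<bullet> (y - x)) + c) has_derivative (\<lambda>h. (G y + (2 * \<delta>) *\<^sub>R (y - x)) \<bullet> h)) (at y)"
    and "(G has_derivative (*v) (H y)) (at y) \<Longrightarrow>
      ((\<lambda>y. G y + (2 * \<delta>) *\<^sub>R (y - x)) has_derivative (*v) (H y + (2 * \<delta>) *\<^sub>R mat 1)) (at y)"
proof -
  assume \<phi>: "(\<phi> has_derivative (\<lambda>h. G y \<bullet> h)) (at y)"
  have "((\<lambda>y. (y - x) \<bullet> (y - x)) has_derivative (\<lambda>h. (y - x) \<bullet> h + h \<bullet> (y - x))) (at y)"
    by (auto intro!: derivative_eq_intros)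
  note \<phi> this
  then show "((\<lambda>y. \<phi> y + \<delta> * ((y - x) \<bullet> (y - x)) + c) has_derivative (\<lambda>h. (G y + (2 * \<delta>) *\<^sub>R (y - x)) \<bullet> h)) (at y)"
    by (auto intro!: derivative_eq_intros simp: inner_add_left inner_commute algebra_simps)
next
  assume "(G has_derivative (*v) (H y)) (at y)"
  then have "((\<lambda>y. G y + (2 * \<delta>) *\<^sub>R (y - x)) has_derivative (\<lambda>h. H y *v h + (2 * \<delta>) *\<^sub>R h)) (at y)"
    by (auto intro!: derivative_eq_intros)
  then show "((\<lambda>y. G y + (2 * \<delta>) *\<^sub>R (y - x)) has_derivative (*v) (H y + (2 * \<delta>) *\<^sub>R mat 1)) (at y)"
    by (rule has_derivative_eq_rhs)
      (simp add: fun_eq_iff matrix_vector_mult_add_rdistrib scaleR_matrix_vector_assoc[symmetric])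
qed

text \<open>Turns strict conditions at the contact point into conditions with a uniform margin on a small ball, as
the crossing lemmas require; \<open>A\<close> is the Hessian of the quadratic perturbation.\<close>

lemma pos_def_det_neighbourhood:
  fixes H :: "real ^ 'n::finite \<Rightarrow> real ^ 'n ^ 'n"
  assumes U: "open U" "x \<in> U" and H: "continuous_on U H" and f: "continuous_on U f"
    and A: "pos_def (H x + A)" and e: "0 < e"
  shows "\<exists>\<rho>>0. cball x \<rho> \<subseteq> U \<and> (\<forall>y\<in>cball x \<rho>. pos_def (H y + A)
    \<and> \<bar>det (H y + A) - det (H x + A)\<bar> < e \<and> \<bar>f y - f x :: real\<bar> < e)"
proof -
  obtain d where d: "0 < d" "\<And>B. norm (B - (H x + A)) < d \<Longrightarrow> pos_def B"
    using eventually_pos_def[OF A] by blast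
  have Hx: "(H \<longlongrightarrow> H x) (at x)" and fx: "(f \<longlongrightarrow> f x) (at x)"
    using U H f by (simp_all add: continuous_on_eq_continuous_at continuous_at)
  have "((\<lambda>y. det (H y + A)) \<longlongrightarrow> det (H x + A)) (at x)"
    by (intro tendsto_intros Hx)
  then have "\<forall>\<^sub>F y in at x. dist (H y) (H x) < d" "\<forall>\<^sub>F y in at x. dist (f y) (f x) < e"
    "\<forall>\<^sub>F y in at x. dist (det (H y + A)) (det (H x + A)) < e"
    using Hx fx d(1) e by (auto dest: tendstoD)
  moreover have "\<forall>\<^sub>F y in at x. y \<in> U"
    using U by (rule eventually_at_in_open')
  ultimately have "\<forall>\<^sub>F y in at x. y \<in> U \<and> pos_def (H y + A)
    \<and> \<bar>det (H y + A) - det (H x + A)\<bar> < e \<and> \<bar>f y - f x\<bar> < e"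
    by eventually_elim (auto simp: dist_norm intro!: d(2))
  then obtain r where r: "0 < r" "\<And>y. y \<noteq> x \<Longrightarrow> dist y x < r \<Longrightarrow> y \<in> U \<and> pos_def (H y + A)
    \<and> \<bar>det (H y + A) - det (H x + A)\<bar> < e \<and> \<bar>f y - f x\<bar> < e"
    unfolding eventually_at by auto
  have "y \<in> U \<and> pos_def (H y + A)
    \<and> \<bar>det (H y + A) - det (H x + A)\<bar> < e \<and> \<bar>f y - f x\<bar> < e" if "y \<in> cball x (r / 2)" for y
    using that r A U(2) e by (cases "y = x") (auto simp: dist_commute)
  then show ?thesis using r(1) by (intro exI[of _ "r / 2"]) auto
qed

text \<open>The Hessian is semidefinite by convexity of \<open>u\<close>. If its determinant were too small, this would remain
true for \<open>\<phi>\<close> plus a small multiple of \<open>\<bar>y - x\<bar>\<^sup>2\<close> in a small ball around \<open>x\<close>, and the Hessian would even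
be definite. The added term makes the contact strict, so that after a small downward shift the function crosses \<open>u\<close>
near \<open>x\<close> but stays above it on the sphere.\<close>

lemma alexandrov_touching_above:
  fixes u :: "real ^ 'n::finite \<Rightarrow> real"
  assumes u: "alexandrov_solution \<Omega> f u" and \<Omega>: "open \<Omega>" and f: "continuous_on \<Omega> f"
    and x: "x \<in> \<Omega>"
    and \<phi>: "\<And>y. y \<in> \<Omega> \<Longrightarrow> (\<phi> has_derivative (\<lambda>h. G y \<bullet> h)) (at y)"
    and G: "\<And>y. y \<in> \<Omega> \<Longrightarrow> (G has_derivative (*v) (H y)) (at y)"
    and H: "continuous_on \<Omega> H"
    and touch: "\<And>y. y \<in> \<Omega> \<Longrightarrow> u y - \<phi> y \<le> u x - \<phi> x"
  shows "0 \<le> h \<bullet> (H x *v h)" and "f x \<le> det (H x)"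
proof -
  have "convex_on \<Omega> u" using u by (simp add: alexandrov_solution_def)
  then have semi: "0 \<le> h \<bullet> (H x *v h)" for h
    using convex_touching_above_semidefinite[OF _ \<Omega> order_refl x \<phi> G H touch] by simp
  then show "0 \<le> h \<bullet> (H x *v h)" .
  show "f x \<le> det (H x)"
  proof (rule ccontr)
    assume "\<not> f x \<le> det (H x)"
    then have gap: "det (H x) < f x" by simp
    have "((\<lambda>\<delta>. det (H x + (2 * \<delta>) *\<^sub>R mat 1)) \<longlongrightarrow> det (H x + (2 * 0) *\<^sub>R mat 1)) (at_right 0)"
      by (intro tendsto_intros)
    then have "\<forall>\<^sub>F \<delta> in at_right 0. det (H x + (2 * \<delta>) *\<^sub>R mat 1) < f x"
      using gap by (intro order_tendstoD) simp_all
    moreover have "\<forall>\<^sub>F \<delta>::real in at_right 0. 0 < \<delta>" by (rule eventually_at_right_less)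
    ultimately obtain \<delta> where \<delta>: "0 < \<delta>" "det (H x + (2 * \<delta>) *\<^sub>R mat 1) < f x"
      using eventually_happens'[OF trivial_limit_at_right_real eventually_conj] by blast
    define A where "A = (2 * \<delta>) *\<^sub>R (mat 1 :: real ^ 'n ^ 'n)"
    have A: "pos_def (H x + A)"
      unfolding pos_def_def A_def
      using semi \<delta>(1) by (auto simp: matrix_vector_mult_add_rdistrib inner_add_right
        scaleR_matrix_vector_assoc[symmetric] intro!: add_nonneg_pos)
    define e where "e = (f x - det (H x + A)) / 3"
    have e: "0 < e" using \<delta>(2) by (simp add: e_def A_def)
    obtain \<rho> where \<rho>: "0 < \<rho>" "cball x \<rho> \<subseteq> \<Omega>"
      and near: "\<And>y. y \<in> cball x \<rho> \<Longrightarrow> pos_def (H y + A)"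
        "\<And>y. y \<in> cball x \<rho> \<Longrightarrow> \<bar>det (H y + A) - det (H x + A)\<bar> < e"
        "\<And>y. y \<in> cball x \<rho> \<Longrightarrow> \<bar>f y - f x\<bar> < e"
      using pos_def_det_neighbourhood[OF \<Omega> x H f A e] by blast
    define c where "c = u x - \<phi> x - \<delta> * \<rho>\<^sup>2 / 2"
    have "u x \<le> \<phi> x + \<delta> * ((x - x) \<bullet> (x - x)) + c"
    proof (rule no_strict_supersolution_crossing[where q = x and \<phi> = "\<lambda>y. \<phi> y + \<delta> * ((y - x) \<bullet> (y - x)) + c" and H = "\<lambda>y. H y + A"
          and G = "\<lambda>y. G y + (2 * \<delta>) *\<^sub>R (y - x)" and a = "det (H x + A) + e" and b = "f x - e",
          OF u \<Omega> f \<rho>])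
      fix y assume y: "y \<in> cball x \<rho>"
      then have "y \<in> \<Omega>" using \<rho>(2) by blast
      from quadratic_perturbation(1)[where G = G, OF \<phi>[OF this]] quadratic_perturbation(2)[where H = H, OF G[OF this]]
      show "((\<lambda>y. \<phi> y + \<delta> * ((y - x) \<bullet> (y - x)) + c) has_derivative
          (\<lambda>h. (G y + (2 * \<delta>) *\<^sub>R (y - x)) \<bullet> h)) (at y)"
        "((\<lambda>y. G y + (2 * \<delta>) *\<^sub>R (y - x)) has_derivative (*v) (H y + A)) (at y)"
        unfolding A_def .
      show "pos_def (H y + A)" "det (H y + A) \<le> det (H x + A) + e" "f x - e \<le> f y"
        using near[OF y] by (auto simp: abs_less_iff)
    next
      show "continuous_on (cball x \<rho>) (\<lambda>y. H y + A)"
        using continuous_on_subset[OF H \<rho>(2)] by (intro continuous_intros)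
      show "det (H x + A) + e < f x - e" using e unfolding e_def by (simp add: field_simps)
    next
      fix y assume "y \<in> sphere x \<rho>"
      then have y: "norm (y - x) = \<rho>" "y \<in> \<Omega>" using \<rho>(2) by (auto simp: dist_norm norm_minus_commute)
      then have "(y - x) \<bullet> (y - x) = \<rho>\<^sup>2" by (simp add: power2_norm_eq_inner[symmetric])
      then show "u y < \<phi> y + \<delta> * ((y - x) \<bullet> (y - x)) + c"
        using touch[OF y(2)] mult_pos_pos[OF \<delta>(1) zero_less_power[OF \<rho>(1), of 2]]
        by (simp add: c_def)
    qed
    then show False
    using mult_pos_pos[OF \<delta>(1) zero_less_power[OF \<rho>(1), of 2]] by (simp add: c_def)
  qed
qed

text \<open>The mirror image of \<open>alexandrov_touching_above\<close>, with a small multiple of \<open>\<bar>y - x\<bar>\<^sup>2\<close> subtracted. Contact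
from below does not force the Hessian to be definite, so this is a hypothesis here.\<close>

lemma alexandrov_touching_below:
  fixes u :: "real ^ 'n::finite \<Rightarrow> real"
  assumes u: "alexandrov_solution \<Omega> f u" and \<Omega>: "open \<Omega>" and f: "continuous_on \<Omega> f"
    and f_pos: "\<And>y. y \<in> \<Omega> \<Longrightarrow> 0 < f y"
    and x: "x \<in> \<Omega>"
    and \<phi>: "\<And>y. y \<in> \<Omega> \<Longrightarrow> (\<phi> has_derivative (\<lambda>h. G y \<bullet> h)) (at y)"
    and G: "\<And>y. y \<in> \<Omega> \<Longrightarrow> (G has_derivative (*v) (H y)) (at y)"
    and H: "continuous_on \<Omega> H" "pos_def (H x)"
    and touch: "\<And>y. y \<in> \<Omega> \<Longrightarrow> u x - \<phi> x \<le> u y - \<phi> y"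
  shows "det (H x) \<le> f x"
proof (rule ccontr)
  assume "\<not> det (H x) \<le> f x"
  then have gap: "f x < det (H x)" by simp
  have "((\<lambda>\<delta>. det (H x + (2 * - \<delta>) *\<^sub>R mat 1)) \<longlongrightarrow> det (H x + (2 * - 0) *\<^sub>R mat 1)) (at_right 0)"
    by (intro tendsto_intros)
  then have "\<forall>\<^sub>F \<delta> in at_right 0. f x < det (H x + (2 * - \<delta>) *\<^sub>R mat 1)"
    using gap by (intro order_tendstoD) simp_all
  moreover have "\<forall>\<^sub>F \<delta> in at_right 0. pos_def (H x + (2 * - \<delta>) *\<^sub>R mat 1)"
  proof -
    obtain d where d: "0 < d" "\<And>B. norm (B - H x) < d \<Longrightarrow> pos_def B"
      using eventually_pos_def[OF H(2)] by blast
    have "((\<lambda>\<delta>::real. norm ((2 * - \<delta>) *\<^sub>R (mat 1 :: real ^ 'n ^ 'n))) \<longlongrightarrow>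
        norm ((2 * - 0) *\<^sub>R (mat 1 :: real ^ 'n ^ 'n))) (at_right 0)"
      by (intro tendsto_intros)
    then have "\<forall>\<^sub>F \<delta> in at_right 0. norm ((2 * - \<delta>) *\<^sub>R (mat 1 :: real ^ 'n ^ 'n)) < d"
      using d(1) by (intro order_tendstoD) simp_all
    then show ?thesis by eventually_elim (intro d(2), simp)
  qed
  moreover have "\<forall>\<^sub>F \<delta>::real in at_right 0. 0 < \<delta>" by (rule eventually_at_right_less)
  ultimately have "\<forall>\<^sub>F \<delta> in at_right 0. 0 < \<delta> \<and> f x < det (H x + (2 * - \<delta>) *\<^sub>R mat 1)
      \<and> pos_def (H x + (2 * - \<delta>) *\<^sub>R mat 1)"
    by eventually_elim simp
  then obtain \<delta> where \<delta>: "0 < \<delta>" "f x < det (H x + (2 * - \<delta>) *\<^sub>R mat 1)"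
      "pos_def (H x + (2 * - \<delta>) *\<^sub>R mat 1)"
    using eventually_happens'[OF trivial_limit_at_right_real] by blast
  define A where "A = (2 * - \<delta>) *\<^sub>R (mat 1 :: real ^ 'n ^ 'n)"
  have A: "pos_def (H x + A)" using \<delta>(3) by (simp add: A_def)
  define e where "e = (det (H x + A) - f x) / 3"
  have e: "0 < e" using \<delta>(2) by (simp add: e_def A_def)
  obtain \<rho> where \<rho>: "0 < \<rho>" "cball x \<rho> \<subseteq> \<Omega>"
    and near: "\<And>y. y \<in> cball x \<rho> \<Longrightarrow> pos_def (H y + A)"
      "\<And>y. y \<in> cball x \<rho> \<Longrightarrow> \<bar>det (H y + A) - det (H x + A)\<bar> < e"
      "\<And>y. y \<in> cball x \<rho> \<Longrightarrow> \<bar>f y - f x\<bar> < e"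
    using pos_def_det_neighbourhood[OF \<Omega> x H(1) f A e] by blast
  define c where "c = u x - \<phi> x + \<delta> * \<rho>\<^sup>2 / 2"
  have "\<phi> x + - \<delta> * ((x - x) \<bullet> (x - x)) + c \<le> u x"
  proof (rule no_strict_subsolution_crossing[where q = x and \<phi> = "\<lambda>y. \<phi> y + - \<delta> * ((y - x) \<bullet> (y - x)) + c" and H = "\<lambda>y. H y + A"
        and G = "\<lambda>y. G y + (2 * - \<delta>) *\<^sub>R (y - x)" and b = "det (H x + A) - e" and a = "f x + e",
        OF u \<Omega> f \<rho>])
    fix y assume y: "y \<in> cball x \<rho>"
    then have "y \<in> \<Omega>" using \<rho>(2) by blast
    from quadratic_perturbation(1)[where G = G, OF \<phi>[OF this]] quadratic_perturbation(2)[where H = H, OF G[OF this]]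
    show "((\<lambda>y. \<phi> y + - \<delta> * ((y - x) \<bullet> (y - x)) + c) has_derivative
        (\<lambda>h. (G y + (2 * - \<delta>) *\<^sub>R (y - x)) \<bullet> h)) (at y)"
      "((\<lambda>y. G y + (2 * - \<delta>) *\<^sub>R (y - x)) has_derivative (*v) (H y + A)) (at y)"
      unfolding A_def .
    show "pos_def (H y + A)" "det (H x + A) - e \<le> det (H y + A)" "f y \<le> f x + e"
      using near[OF y] by (auto simp: abs_less_iff)
  next
    show "continuous_on (cball x \<rho>) (\<lambda>y. H y + A)"
      using continuous_on_subset[OF H(1) \<rho>(2)] by (intro continuous_intros)
    show "f x + e < det (H x + A) - e" using e unfolding e_def by (simp add: field_simps)
  next
    fix y assume "y \<in> sphere x \<rho>"
    then have y: "norm (y - x) = \<rho>" "y \<in> \<Omega>" using \<rho>(2) by (auto simp: dist_norm norm_minus_commute)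
    then have "(y - x) \<bullet> (y - x) = \<rho>\<^sup>2" by (simp add: power2_norm_eq_inner[symmetric])
    then show "\<phi> y + - \<delta> * ((y - x) \<bullet> (y - x)) + c < u y"
      using touch[OF y(2)] mult_pos_pos[OF \<delta>(1) zero_less_power[OF \<rho>(1), of 2]]
        by (simp add: c_def)
  qed (rule f_pos)
  then show False
    using mult_pos_pos[OF \<delta>(1) zero_less_power[OF \<rho>(1), of 2]] by (simp add: c_def)
qed

section \<open>Diagonal matrices with a rank-one perturbation\<close>

definition diag_rank_one :: "('n \<Rightarrow> real) \<Rightarrow> real \<Rightarrow> ('n \<Rightarrow> real) \<Rightarrow> real ^ 'n ^ 'n"
  where "diag_rank_one D c w = (\<chi> i j. (if i = j then D i else 0) + c * (w i * w j))"

lemma diag_rank_one_mult: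
  "(diag_rank_one D c w *v h) $ i = D i * h $ i + c * w i * (\<Sum>j\<in>UNIV. w j * h $ j)"
proof -
  have "(diag_rank_one D c w *v h) $ i
      = (\<Sum>j\<in>UNIV. (if i = j then D i * h $ j else 0) + c * w i * (w j * h $ j))"
    unfolding diag_rank_one_def matrix_vector_mult_def
    by (auto simp: algebra_simps intro!: sum.cong)
  then show ?thesis
    by (simp add: sum.distrib sum_distrib_left)
qed

lemma diag_rank_one_quadratic:
  "h \<bullet> (diag_rank_one D c w *v h) = (\<Sum>i\<in>UNIV. D i * (h $ i)\<^sup>2) + c * (\<Sum>i\<in>UNIV. w i * h $ i)\<^sup>2"
proof -
  have "h \<bullet> (diag_rank_one D c w *v h)
      = (\<Sum>i\<in>UNIV. D i * (h $ i)\<^sup>2 + c * (\<Sum>j\<in>UNIV. w j * h $ j) * (w i * h $ i))"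
    unfolding inner_vec_def by (simp add: diag_rank_one_mult power2_eq_square algebra_simps)
  then show ?thesis
    by (simp add: sum.distrib sum_distrib_left[symmetric] power2_eq_square)
qed

text \<open>Subtracting multiples of the full row from the rows in \<open>S\<close> makes them diagonal; expanding the full row
then leaves only its \<open>a\<close>-th entry.\<close>

lemma det_one_full_row:
  fixes w :: "'n::finite \<Rightarrow> real"
  assumes "a \<notin> S"
  shows "det (\<chi> i j. if i = a then w j else (if i = j then D i else 0) + (if i \<in> S then t i * w j else 0))
    = w a * (\<Prod>j\<in>UNIV - {a}. D j)"
  using finite[of S] assms
proof (induction S rule: finite_induct)
  case empty
  let ?e = "\<lambda>j. axis j 1 :: real ^ 'n"
  let ?B = "\<lambda>j. (\<chi> i. if i = a then w j *s ?e j else D i *s ?e i) :: real ^ 'n ^ 'n"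
  have w: "(\<Sum>j\<in>UNIV. w j *s ?e j) = (\<chi> j. w j)"
    by (simp add: vec_eq_iff axis_def if_distrib cong: if_cong)
  have "det (\<chi> i j. if i = a then w j else (if i = j then D i else 0) + (if i \<in> {} then t i * w j else 0))
      = det ((\<chi> i. if i = a then (\<Sum>j\<in>UNIV. w j *s ?e j) else D i *s ?e i) :: real ^ 'n ^ 'n)"
    unfolding w by (rule arg_cong[where f = det]) (auto simp: vec_eq_iff axis_def)
  also have "\<dots> = (\<Sum>j\<in>UNIV. det (?B j))"
    by (rule det_linear_row_sum) simp
  also have "\<dots> = (\<Sum>j\<in>UNIV. if j = a then w a * (\<Prod>j\<in>UNIV - {a}. D j) else 0)"
  proof (rule sum.cong[OF refl])
    fix j
    show "det (?B j) = (if j = a then w a * (\<Prod>j\<in>UNIV - {a}. D j) else 0)"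
    proof (cases "j = a")
      case True
      have "det (?B a) = (\<Prod>i\<in>UNIV. ?B a $ i $ i)"
        by (rule det_diagonal) (auto simp: axis_def)
      also have "\<dots> = (\<Prod>i\<in>UNIV. if i = a then w a else D i)"
        by (rule prod.cong) (auto simp: axis_def)
      also have "\<dots> = w a * (\<Prod>j\<in>UNIV - {a}. D j)"
        by (subst prod.remove[of _ a]) (auto intro!: arg_cong2[where f = "(*)"] prod.cong)
      finally show ?thesis unfolding True by simp
    next
      case False
      have "det (?B j) = w j * det ((\<chi> i. if i = a then ?e j else D i *s ?e i) :: real ^ 'n ^ 'n)"
        by (rule det_row_mul)
      also have "((\<chi> i. if i = a then ?e j else D i *s ?e i) :: real ^ 'n ^ 'n)
          = (\<chi> i. if i = j then D j *s ?e j else (if i = a then ?e j else D i *s ?e i))"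
        using False by (auto simp: vec_eq_iff)
      also have "det \<dots> = D j * det ((\<chi> i. if i = j then ?e j else (if i = a then ?e j else D i *s ?e i)) :: real ^ 'n ^ 'n)"
        by (rule det_row_mul)
      also have "det ((\<chi> i. if i = j then ?e j else (if i = a then ?e j else D i *s ?e i)) :: real ^ 'n ^ 'n) = 0"
        by (rule det_identical_rows[OF False]) (simp add: row_def vec_eq_iff)
      finally show ?thesis using False by simp
    qed
  qed
  also have "\<dots> = w a * (\<Prod>j\<in>UNIV - {a}. D j)" by simp
  finally show ?case .
next
  case (insert b S)
  let ?M = "\<lambda>S i j. if i = a then w j else (if i = j then D i else 0) + (if i \<in> S then t i * w j else 0)"
  let ?r = "\<lambda>i. (\<chi> j. ?M S i j) :: real ^ 'n" and ?w = "(\<chi> j. w j) :: real ^ 'n"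
  have ab: "a \<noteq> b" using insert.prems by auto
  have "det (\<chi> i j. ?M (insert b S) i j)
      = det ((\<chi> i. if i = b then ?r b + t b *s ?w else ?r i) :: real ^ 'n ^ 'n)"
    using ab insert.hyps by (intro arg_cong[where f = det]) (auto simp: vec_eq_iff)
  also have "\<dots> = det ((\<chi> i. if i = b then ?r b else ?r i) :: real ^ 'n ^ 'n)
      + det ((\<chi> i. if i = b then t b *s ?w else ?r i) :: real ^ 'n ^ 'n)"
    by (rule det_row_add)
  also have "det ((\<chi> i. if i = b then t b *s ?w else ?r i) :: real ^ 'n ^ 'n)
      = t b * det ((\<chi> i. if i = b then ?w else ?r i) :: real ^ 'n ^ 'n)"
    by (rule det_row_mul)
  also have "det ((\<chi> i. if i = b then ?w else ?r i) :: real ^ 'n ^ 'n) = 0"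
    by (rule det_identical_rows[OF ab]) (simp add: row_def vec_eq_iff)
  also have "((\<chi> i. if i = b then ?r b else ?r i) :: real ^ 'n ^ 'n) = (\<chi> i j. ?M S i j)"
    by (auto simp: vec_eq_iff)
  finally show ?case using insert by simp
qed

text \<open>By multilinearity in the rows: two rows that are both multiples of \<open>w\<close> annihilate the determinant, so
at most one row can contribute its rank-one part.\<close>

lemma det_diag_rank_one:
  fixes w :: "'n::finite \<Rightarrow> real"
  shows "det (diag_rank_one D c w) = (\<Prod>i\<in>UNIV. D i) + (\<Sum>i\<in>UNIV. c * (w i)\<^sup>2 * (\<Prod>j\<in>UNIV - {i}. D j))"
proof -
  let ?M = "\<lambda>S i j. (if i = j then D i else 0) + (if i \<in> S then c * w i * w j else 0)"
  have "det (\<chi> i j. ?M S i j) = (\<Prod>i\<in>UNIV. D i) + (\<Sum>i\<in>S. c * (w i)\<^sup>2 * (\<Prod>j\<in>UNIV - {i}. D j))"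
    for S :: "'n set"
    using finite[of S]
  proof (induction S rule: finite_induct)
    case empty
    show ?case by (simp add: det_diagonal)
  next
    case (insert a S)
    let ?r = "\<lambda>i. (\<chi> j. ?M S i j) :: real ^ 'n" and ?w = "(\<chi> j. w j) :: real ^ 'n"
    have "det (\<chi> i j. ?M (insert a S) i j)
        = det ((\<chi> i. if i = a then ?r a + (c * w a) *s ?w else ?r i) :: real ^ 'n ^ 'n)"
      using insert.hyps by (intro arg_cong[where f = det]) (auto simp: vec_eq_iff)
    also have "\<dots> = det ((\<chi> i. if i = a then ?r a else ?r i) :: real ^ 'n ^ 'n)
        + det ((\<chi> i. if i = a then (c * w a) *s ?w else ?r i) :: real ^ 'n ^ 'n)"
      by (rule det_row_add)
    also have "det ((\<chi> i. if i = a then (c * w a) *s ?w else ?r i) :: real ^ 'n ^ 'n)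
        = c * w a * det ((\<chi> i. if i = a then ?w else ?r i) :: real ^ 'n ^ 'n)"
      by (rule det_row_mul)
    also have "((\<chi> i. if i = a then ?w else ?r i) :: real ^ 'n ^ 'n)
        = (\<chi> i j. if i = a then w j else (if i = j then D i else 0) + (if i \<in> S then c * w i * w j else 0))"
      by (auto simp: vec_eq_iff)
    also have "det \<dots> = w a * (\<Prod>j\<in>UNIV - {a}. D j)"
      using insert.hyps(2) by (rule det_one_full_row[where t = "\<lambda>i. c * w i"])
    also have "((\<chi> i. if i = a then ?r a else ?r i) :: real ^ 'n ^ 'n) = (\<chi> i j. ?M S i j)"
      by (auto simp: vec_eq_iff)
    finally show ?case
      using insert by (simp add: power2_eq_square algebra_simps)
  qed
  from this[of UNIV] show ?thesis
    by (simp add: diag_rank_one_def mult.assoc)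
qed

lemma prod_plus_ge:
  fixes D q :: "'a \<Rightarrow> real"
  assumes "finite S" and "\<And>i. i \<in> S \<Longrightarrow> 0 \<le> D i" and "\<And>i. i \<in> S \<Longrightarrow> 0 \<le> q i"
  shows "(\<Prod>i\<in>S. D i) + (\<Sum>i\<in>S. q i * (\<Prod>j\<in>S - {i}. D j)) \<le> (\<Prod>i\<in>S. D i + q i)"
  using assms
proof (induction S rule: finite_induct)
  case empty
  then show ?case by simp
next
  case (insert a S)
  let ?P = "\<Prod>i\<in>S. D i" and ?Q = "\<Sum>i\<in>S. q i * (\<Prod>j\<in>S - {i}. D j)"
  have rest: "(\<Sum>i\<in>S. q i * (\<Prod>j\<in>insert a S - {i}. D j)) = D a * ?Q"
    unfolding sum_distrib_left
  proof (rule sum.cong[OF refl])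
    fix i assume "i \<in> S"
    then have "insert a S - {i} = insert a (S - {i})" using insert.hyps by auto
    then show "q i * (\<Prod>j\<in>insert a S - {i}. D j) = D a * (q i * (\<Prod>j\<in>S - {i}. D j))"
      using insert.hyps by simp
  qed
  have Q: "0 \<le> ?Q"
    using insert.prems by (intro sum_nonneg mult_nonneg_nonneg prod_nonneg) auto
  have "insert a S - {a} = S" using insert.hyps by auto
  then have "(\<Prod>i\<in>insert a S. D i) + (\<Sum>i\<in>insert a S. q i * (\<Prod>j\<in>insert a S - {i}. D j))
      = (D a + q a) * (?P + ?Q) - q a * ?Q"
    using insert.hyps by (simp add: rest algebra_simps)
  also have "\<dots> \<le> (D a + q a) * (?P + ?Q)" using Q insert.prems by simp
  also have "\<dots> \<le> (D a + q a) * (\<Prod>i\<in>S. D i + q i)"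
    using insert by (intro mult_left_mono) auto
  finally show ?case using insert.hyps by simp
qed

text \<open>Hadamard's inequality for this class of matrices. If all \<open>D i\<close> are nonnegative, the right-hand side expands
into nonnegative terms among which those of the determinant occur. The Hessian of the upper barrier may
also have a negative \<open>D i\<close>, but semidefiniteness allows at most one.\<close>

lemma det_diag_rank_one_le:
  fixes w :: "'n::finite \<Rightarrow> real"
  assumes c: "0 \<le> c"
    and semi: "\<And>h. 0 \<le> h \<bullet> (diag_rank_one D c w *v h)"
  shows "det (diag_rank_one D c w) \<le> (\<Prod>i\<in>UNIV. D i + c * (w i)\<^sup>2)"
    and "\<And>i. 0 \<le> D i + c * (w i)\<^sup>2"
proof -
  define q where "q i = c * (w i)\<^sup>2" for i
  have q: "0 \<le> q i" for i using c by (simp add: q_def)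
  show diag: "0 \<le> D i + c * (w i)\<^sup>2" for i
  proof -
    have "(\<Sum>j\<in>UNIV. D j * (axis i 1 $ j)\<^sup>2) = (\<Sum>j\<in>UNIV. if j = i then D i else 0)"
      "(\<Sum>j\<in>UNIV. w j * axis i 1 $ j) = (\<Sum>j\<in>UNIV. if j = i then w i else 0)"
      by (rule sum.cong, simp, simp add: axis_def)+
    then show ?thesis using semi[of "axis i 1"] by (simp add: diag_rank_one_quadratic)
  qed
  show "det (diag_rank_one D c w) \<le> (\<Prod>i\<in>UNIV. D i + c * (w i)\<^sup>2)"
  proof (cases "\<forall>i. 0 \<le> D i")
    case True
    then show ?thesis
      using prod_plus_ge[of UNIV D q] q by (simp add: det_diag_rank_one q_def)
  next
    case False
    then obtain a where a: "D a < 0" by (auto simp: not_le)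
    have wa: "w a \<noteq> 0" using diag[of a] a by auto
    have others: "0 \<le> D b" if "b \<noteq> a" for b
    proof -
      (* This vector is orthogonal to w, so only the diagonal part is tested. *)
      let ?h = "(\<chi> j. if j = a then w b else if j = b then - w a else 0) :: real ^ 'n"
      have "(\<Sum>j\<in>UNIV. D j * (?h $ j)\<^sup>2) = (\<Sum>j\<in>{a, b}. D j * (?h $ j)\<^sup>2)"
        by (rule sum.mono_neutral_right) auto
      moreover have "(\<Sum>j\<in>UNIV. w j * ?h $ j) = (\<Sum>j\<in>{a, b}. w j * ?h $ j)"
        by (rule sum.mono_neutral_right) auto
      ultimately have "0 \<le> D a * (w b)\<^sup>2 + D b * (w a)\<^sup>2"
        using semi[of ?h] that by (simp add: diag_rank_one_quadratic)
      moreover have "D a * (w b)\<^sup>2 \<le> 0" using a by (simp add: mult_nonpos_nonneg)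
      ultimately have "0 \<le> D b * (w a)\<^sup>2" by linarith
      then show ?thesis using wa by (simp add: zero_le_mult_iff)
    qed
    let ?R = "UNIV - {a}"
    let ?P = "\<Prod>j\<in>?R. D j" and ?Q = "\<Sum>i\<in>?R. q i * (\<Prod>j\<in>?R - {i}. D j)"
    have rest: "(\<Sum>i\<in>?R. q i * (\<Prod>j\<in>UNIV - {i}. D j)) = D a * ?Q"
      unfolding sum_distrib_left
    proof (rule sum.cong[OF refl])
      fix i assume "i \<in> ?R"
      then have "UNIV - {i} = insert a (?R - {i})" by auto
      then show "q i * (\<Prod>j\<in>UNIV - {i}. D j) = D a * (q i * (\<Prod>j\<in>?R - {i}. D j))" by simp
    qed
    have Q: "0 \<le> ?Q"
      using others q by (intro sum_nonneg mult_nonneg_nonneg prod_nonneg) auto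
    have "det (diag_rank_one D c w) = D a * ?P + (q a * ?P + D a * ?Q)"
      unfolding det_diag_rank_one q_def[symmetric]
      by (subst (1) prod.remove[of UNIV a], simp, simp, subst sum.remove[of UNIV a], simp, simp, simp add: rest)
    also have "\<dots> \<le> (D a + q a) * ?P"
      using a Q by (simp add: algebra_simps mult_nonpos_nonneg)
    also have "\<dots> \<le> (D a + q a) * (\<Prod>i\<in>?R. D i + q i)"
      using diag[of a] others q by (intro mult_left_mono prod_mono) (auto simp: q_def)
    also have "\<dots> = (\<Prod>i\<in>UNIV. D i + q i)"
      using prod.remove[of UNIV a "\<lambda>i. D i + q i"] by simp
    finally show ?thesis by (simp add: q_def)
  qed
qed

text \<open>The Cauchy-Schwarz inequality for the inner product with weights \<open>D\<close>.\<close>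

lemma pos_def_diag_minus_rank_one:
  fixes w :: "'n::finite \<Rightarrow> real"
  assumes D: "\<And>i. 0 < D i" and c: "0 \<le> c" and small: "c * (\<Sum>i\<in>UNIV. (w i)\<^sup>2 / D i) < 1"
  shows "pos_def (diag_rank_one D (- c) w)"
  unfolding pos_def_def
proof (intro allI impI)
  fix h :: "real ^ 'n" assume "h \<noteq> 0"
  let ?E = "\<Sum>i\<in>UNIV. D i * (h $ i)\<^sup>2" and ?W = "\<Sum>i\<in>UNIV. (w i)\<^sup>2 / D i"
  obtain i where "h $ i \<noteq> 0" using \<open>h \<noteq> 0\<close> by (auto simp: vec_eq_iff)
  then have E: "0 < ?E"
    using D by (intro sum_pos2[of UNIV i]) (simp_all add: less_imp_le)
  have "(\<Sum>i\<in>UNIV. w i * h $ i)\<^sup>2 = (\<Sum>i\<in>UNIV. (w i / sqrt (D i)) * (sqrt (D i) * h $ i))\<^sup>2"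
    using D by (intro arg_cong[where f = "\<lambda>x. x\<^sup>2"] sum.cong) (auto simp: less_imp_neq[symmetric])
  also have "\<dots> \<le> (\<Sum>i\<in>UNIV. (w i / sqrt (D i))\<^sup>2) * (\<Sum>i\<in>UNIV. (sqrt (D i) * h $ i)\<^sup>2)"
    by (rule Cauchy_Schwarz_ineq_sum)
  also have "\<dots> = ?W * ?E"
    using D by (simp add: power_divide power_mult_distrib less_imp_le)
  finally have "c * (\<Sum>i\<in>UNIV. w i * h $ i)\<^sup>2 \<le> (c * ?W) * ?E"
    using c by (simp add: mult.assoc mult_left_mono)
  also have "\<dots> < 1 * ?E" using small E by (rule mult_strict_right_mono)
  finally show "0 < h \<bullet> (diag_rank_one D (- c) w *v h)"
    by (simp add: diag_rank_one_quadratic)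
qed

lemma det_diag_rank_one_factored:
  fixes w :: "'n::finite \<Rightarrow> real"
  assumes D: "\<And>i. 0 < D i"
  shows "det (diag_rank_one D c w) = (\<Prod>i\<in>UNIV. D i) * (1 + c * (\<Sum>i\<in>UNIV. (w i)\<^sup>2 / D i))"
proof -
  have "c * (w i)\<^sup>2 * (\<Prod>j\<in>UNIV - {i}. D j) = (\<Prod>i\<in>UNIV. D i) * (c * ((w i)\<^sup>2 / D i))" for i
    using D[of i] prod.remove[of UNIV i D] by simp
  then show ?thesis
    by (simp add: det_diag_rank_one algebra_simps sum_distrib_left)
qed

text \<open>By the arithmetic-geometric mean inequality the product is at most \<open>(1 - m)^card S\<close>, which is at most
\<open>(1 - m)\<^sup>2\<close>, and \<open>1 - (1 + \<delta>) m - (1 - m)\<^sup>2 = m (1 - \<delta> - m)\<close>.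
The exponent \<open>2\<close> is where at least two factors are required.\<close>

lemma product_gain:
  fixes z :: "'a \<Rightarrow> real"
  assumes S: "finite S" "2 \<le> card S" and z: "\<And>i. i \<in> S \<Longrightarrow> 0 \<le> z i \<and> z i < 1"
    and m: "m = (\<Sum>i\<in>S. z i) / card S" and \<delta>: "0 \<le> \<delta>" "m < 1 - \<delta>"
  shows "1 + m * (1 - \<delta> - m) \<le> (1 - (1 + \<delta>) * m) / (\<Prod>i\<in>S. 1 - z i)"
proof -
  let ?k = "real (card S)"
  have k: "0 < ?k" "S \<noteq> {}" using S by auto
  have m01: "0 \<le> m" "m < 1"
    using z \<delta> unfolding m by (auto intro!: divide_nonneg_nonneg sum_nonneg)
  have P: "0 < (\<Prod>i\<in>S. 1 - z i)" using z by (intro prod_pos) simp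
  have "(\<Prod>i\<in>S. 1 - z i) powr (1 / ?k) \<le> (\<Sum>i\<in>S. (1 - z i) / ?k)"
    using S k z by (intro arith_geom_mean) (auto simp: less_imp_le)
  also have "\<dots> = 1 - m"
    using k by (simp add: m sum_divide_distrib[symmetric] sum_subtractf diff_divide_distrib)
  finally have "((\<Prod>i\<in>S. 1 - z i) powr (1 / ?k)) powr ?k \<le> (1 - m) powr ?k"
    by (intro powr_mono2) auto
  then have "(\<Prod>i\<in>S. 1 - z i) \<le> (1 - m) ^ card S"
    using P k m01 by (simp add: powr_powr powr_realpow)
  also have "\<dots> \<le> (1 - m) ^ 2"
    using m01 S by (intro power_decreasing) auto
  finally have P2: "(\<Prod>i\<in>S. 1 - z i) \<le> (1 - m)\<^sup>2" .
  have gain: "0 \<le> m * (1 - \<delta> - m)" using m01 \<delta> by simp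
  have "(1 + m * (1 - \<delta> - m)) * (\<Prod>i\<in>S. 1 - z i) \<le> (1 + m * (1 - \<delta> - m)) * (1 - m)\<^sup>2"
    using P2 gain by (intro mult_left_mono) auto
  also have "\<dots> = (1 - m)\<^sup>2 + m * (1 - \<delta> - m) * (1 - m)\<^sup>2"
    by (simp add: algebra_simps)
  also have "\<dots> \<le> (1 - m)\<^sup>2 + m * (1 - \<delta> - m) * 1"
    using gain m01 by (intro add_left_mono mult_left_mono power_le_one) auto
  also have "\<dots> = 1 - (1 + \<delta>) * m"
    by (simp add: power2_eq_square algebra_simps)
  finally show ?thesis using P by (simp add: pos_le_divide_eq)
qed

section \<open>Barriers\<close>

definition log_sum :: "'n set \<Rightarrow> real ^ 'n::finite \<Rightarrow> real"
  where "log_sum K x = (\<Sum>i\<in>K. ln (x $ i))"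

text \<open>The first term is \<open>a\<close> times the \<open>\<beta>\<close>-th power of the product of the coordinates in \<open>K\<close>; in this form its
logarithmic derivatives are immediate.\<close>

definition perturbation :: "'n set \<Rightarrow> real \<Rightarrow> real \<Rightarrow> real \<Rightarrow> real \<Rightarrow> real ^ 'n::finite \<Rightarrow> real"
  where "perturbation K \<beta> a b c x =
    a * exp (\<beta> * log_sum K x) + b * (1 + (\<Sum>i\<in>K. x $ i)) + c / 2 * (\<Sum>i\<in>- K. (x $ i)\<^sup>2)"

definition barrier :: "'n set \<Rightarrow> real \<Rightarrow> real \<Rightarrow> real \<Rightarrow> real \<Rightarrow> real ^ 'n::finite \<Rightarrow> real"
  where "barrier K \<beta> a b c x = model_solution K x + perturbation K \<beta> a b c x"

definition barrier_gradient :: "'n set \<Rightarrow> real \<Rightarrow> real \<Rightarrow> real \<Rightarrow> real \<Rightarrow> real ^ 'n::finite \<Rightarrow> real ^ 'n"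
  where "barrier_gradient K \<beta> a b c x =
    (\<chi> i. if i \<in> K then ln (x $ i) + 1 + a * \<beta> * exp (\<beta> * log_sum K x) / x $ i + b else (1 + c) * x $ i)"

definition barrier_hessian :: "'n set \<Rightarrow> real \<Rightarrow> real \<Rightarrow> real \<Rightarrow> real ^ 'n::finite \<Rightarrow> real ^ 'n ^ 'n"
  where "barrier_hessian K \<beta> a c x = (let s = a * \<beta> * exp (\<beta> * log_sum K x) in
    diag_rank_one (\<lambda>i. if i \<in> K then 1 / x $ i - s / (x $ i)\<^sup>2 else 1 + c) (\<beta> * s)
      (\<lambda>i. if i \<in> K then 1 / x $ i else 0))"

lemma open_orthant: "open (orthant K)"
proof -
  have "orthant K = (\<Inter>a\<in>K. {x. 0 < x $ a})" by (auto simp: orthant_def)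
  then show ?thesis by (simp add: open_INT open_halfspace_component_gt_cart)
qed

lemma has_derivative_nth: "((\<lambda>x::real ^ 'n::finite. x $ i) has_derivative (\<lambda>h. h $ i)) (at x)"
  by (rule bounded_linear_imp_has_derivative[OF bounded_linear_vec_nth])

lemma has_derivative_ln_nth:
  fixes x :: "real ^ 'n::finite"
  assumes "0 < x $ i"
  shows "((\<lambda>x. ln (x $ i)) has_derivative (\<lambda>h. h $ i / x $ i)) (at x)"
  using has_derivative_ln[OF assms has_derivative_nth]
  by (rule has_derivative_eq_rhs) (simp add: fun_eq_iff divide_inverse mult.commute)

lemma has_derivative_power_term:
  assumes "x \<in> orthant K"
  shows "((\<lambda>x. exp (\<beta> * log_sum K x)) has_derivative
    (\<lambda>h. \<beta> * exp (\<beta> * log_sum K x) * (\<Sum>i\<in>K. h $ i / x $ i))) (at x)"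
proof -
  have "(log_sum K has_derivative (\<lambda>h. \<Sum>i\<in>K. h $ i / x $ i)) (at x)"
    unfolding log_sum_def[abs_def] using assms
    by (intro has_derivative_sum has_derivative_ln_nth) (simp add: orthant_def)
  from has_derivative_exp[OF has_derivative_mult_right[OF this]]
  show ?thesis
    by (rule has_derivative_eq_rhs) (simp add: fun_eq_iff)
qed

lemma sum_split_on:
  fixes K :: "'n::finite set"
  shows "(\<Sum>i\<in>UNIV. f i) = (\<Sum>i\<in>K. f i) + (\<Sum>i\<in>- K. f i)"
  by (subst sum.union_disjoint[symmetric]) (auto simp: Un_commute Compl_partition)

lemma prod_split_on:
  fixes K :: "'n::finite set"
  shows "(\<Prod>i\<in>UNIV. f i) = (\<Prod>i\<in>K. f i) * (\<Prod>i\<in>- K. f i)"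
  by (subst prod.union_disjoint[symmetric]) (auto simp: Un_commute Compl_partition)

lemma barrier_has_derivative:
  assumes x: "x \<in> orthant K"
  shows "(barrier K \<beta> a b c has_derivative (\<lambda>h. barrier_gradient K \<beta> a b c x \<bullet> h)) (at x)"
proof -
  let ?s = "a * \<beta> * exp (\<beta> * log_sum K x)"
  have pos: "0 < x $ i" if "i \<in> K" for i using x that by (simp add: orthant_def)
  have 1: "((\<lambda>x. x $ i * ln (x $ i)) has_derivative (\<lambda>h. (ln (x $ i) + 1) * h $ i)) (at x)" if "i \<in> K" for i
    using pos[OF that] by (auto intro!: derivative_eq_intros has_derivative_nth simp: algebra_simps)
  have 2: "((\<lambda>x. (x $ i)\<^sup>2) has_derivative (\<lambda>h. 2 * x $ i * h $ i)) (at x)" for i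
    by (auto intro!: derivative_eq_intros has_derivative_nth)
  have "(barrier K \<beta> a b c has_derivative (\<lambda>h. (\<Sum>i\<in>K. (ln (x $ i) + 1) * h $ i)
      + 1 / 2 * (\<Sum>i\<in>- K. 2 * x $ i * h $ i)
      + (a * (\<beta> * exp (\<beta> * log_sum K x) * (\<Sum>i\<in>K. h $ i / x $ i))
        + b * (0 + (\<Sum>i\<in>K. h $ i)) + c / 2 * (\<Sum>i\<in>- K. 2 * x $ i * h $ i)))) (at x)"
    unfolding barrier_def[abs_def] model_solution_def perturbation_def
    by (intro has_derivative_add has_derivative_sum has_derivative_mult_right has_derivative_const
        has_derivative_nth has_derivative_power_term x 1 2)
  moreover have "(\<Sum>i\<in>K. (ln (x $ i) + 1) * h $ i) + 1 / 2 * (\<Sum>i\<in>- K. 2 * x $ i * h $ i)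
      + (a * (\<beta> * exp (\<beta> * log_sum K x) * (\<Sum>i\<in>K. h $ i / x $ i))
        + b * (0 + (\<Sum>i\<in>K. h $ i)) + c / 2 * (\<Sum>i\<in>- K. 2 * x $ i * h $ i))
      = barrier_gradient K \<beta> a b c x \<bullet> h" for h
  proof -
    have "barrier_gradient K \<beta> a b c x \<bullet> h
        = (\<Sum>i\<in>K. (ln (x $ i) + 1 + ?s / x $ i + b) * h $ i) + (\<Sum>i\<in>- K. (1 + c) * x $ i * h $ i)"
      unfolding inner_vec_def sum_split_on[of _ K]
      by (intro arg_cong2[where f = "(+)"] sum.cong) (auto simp: barrier_gradient_def)
    then show ?thesis
      by (simp add: sum.distrib sum_distrib_left sum_subtractf algebra_simps)
  qed
  ultimately show ?thesis by simp
qed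

lemma barrier_gradient_has_derivative:
  assumes x: "x \<in> orthant K"
  shows "(barrier_gradient K \<beta> a b c has_derivative (*v) (barrier_hessian K \<beta> a c x)) (at x)"
proof -
  let ?E = "exp (\<beta> * log_sum K x)"
  let ?s = "a * \<beta> * ?E"
  have pos: "0 < x $ i" if "i \<in> K" for i using x that by (simp add: orthant_def)
  have comp: "((\<lambda>y. barrier_gradient K \<beta> a b c y $ i) has_derivative (\<lambda>h. (barrier_hessian K \<beta> a c x *v h) $ i)) (at x)"
    for i
  proof (cases "i \<in> K")
    case True
    have xi: "x $ i \<noteq> 0" using pos[OF True] by simp
    have "((\<lambda>y. ln (y $ i) + 1 + a * \<beta> * exp (\<beta> * log_sum K y) / y $ i + b) has_derivative
        (\<lambda>h. h $ i / x $ i + 0 + (a * \<beta> * (\<beta> * ?E * (\<Sum>j\<in>K. h $ j / x $ j)) * x $ i - ?s * h $ i)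
          / (x $ i * x $ i) + 0)) (at x)"
      by (intro has_derivative_add has_derivative_const has_derivative_ln_nth has_derivative_divide'
          has_derivative_mult_right has_derivative_nth has_derivative_power_term x xi pos True)
    moreover have "(barrier_hessian K \<beta> a c x *v h) $ i
        = h $ i / x $ i + 0 + (a * \<beta> * (\<beta> * ?E * (\<Sum>j\<in>K. h $ j / x $ j)) * x $ i - ?s * h $ i)
          / (x $ i * x $ i) + 0" for h
    proof -
      have "(\<Sum>j\<in>UNIV. (if j \<in> K then 1 / x $ j else 0) * h $ j) = (\<Sum>j\<in>K. h $ j / x $ j)"
        unfolding sum_split_on[of _ K] by simp
      then show ?thesis
        using True xi
        by (simp add: barrier_hessian_def Let_def diag_rank_one_mult power2_eq_square)
          (simp add: field_simps)
    qed
    ultimately show ?thesis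
      using True by (simp add: barrier_gradient_def)
  next
    case False
    have "((\<lambda>y. (1 + c) * y $ i) has_derivative (\<lambda>h. (1 + c) * h $ i)) (at x)"
      by (intro has_derivative_mult_right has_derivative_nth)
    with False show ?thesis
      by (simp add: barrier_gradient_def barrier_hessian_def Let_def diag_rank_one_mult)
  qed
  show ?thesis
  proof (subst has_derivative_componentwise_within, intro ballI)
    fix e :: "real ^ 'a" assume "e \<in> Basis"
    then obtain i where "e = axis i 1" by (auto simp: Basis_vec_def)
    then show "((\<lambda>y. barrier_gradient K \<beta> a b c y \<bullet> e) has_derivative (\<lambda>h. (barrier_hessian K \<beta> a c x *v h) \<bullet> e)) (at x)"
      using comp[of i] by (simp add: inner_axis)
  qed
qed

lemma continuous_on_barrier_hessian: "continuous_on (orthant K) (barrier_hessian K \<beta> a c)"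
proof -
  have ne: "x $ i \<noteq> 0" if "x \<in> orthant K" "i \<in> K" for x i using that by (auto simp: orthant_def)
  have E: "continuous_on (orthant K) (\<lambda>x. exp (\<beta> * log_sum K x))"
    using has_derivative_continuous[OF has_derivative_power_term]
    by (intro continuous_at_imp_continuous_on) auto
  have off: "continuous_on (orthant K) (\<lambda>x. if i \<in> K then 1 / x $ i else 0)" for i
    by (cases "i \<in> K") (simp_all add: ne continuous_on_divide continuous_on_component)
  have diag: "continuous_on (orthant K)
      (\<lambda>x. if i \<in> K then 1 / x $ i - a * \<beta> * exp (\<beta> * log_sum K x) / (x $ i)\<^sup>2 else 1 + c)" for i
  proof (cases "i \<in> K")
    case True
    then show ?thesis
      by (simp only: if_True) (intro continuous_on_diff continuous_on_divide continuous_on_mult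
          continuous_on_power continuous_on_component continuous_on_const continuous_on_id E, simp_all add: ne)
  qed simp
  have entry: "continuous_on (orthant K) (\<lambda>x. if i = j
      then if i \<in> K then 1 / x $ i - a * \<beta> * exp (\<beta> * log_sum K x) / (x $ i)\<^sup>2 else 1 + c else 0)" for i j
    using diag[of j] by (cases "i = j") (hypsubst, simp_all)
  show ?thesis
    unfolding barrier_hessian_def Let_def diag_rank_one_def
    by (intro continuous_on_vec_lambda continuous_on_add continuous_on_mult continuous_on_const entry off E)
qed

text \<open>The diagonal entries of the Hessian are \<open>(1 / x\<^sub>j) (1 - (1 - \<beta>) s / x\<^sub>j)\<close> on \<open>K\<close>, where \<open>s\<close> is \<open>\<beta>\<close> times the
power term, and Hadamard's inequality bounds the determinant by their product. One coordinate that is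
not much larger than \<open>s\<close> already makes the product smaller by a definite factor.\<close>

lemma upper_barrier_strict:
  assumes x: "x \<in> orthant K" and a: "0 \<le> a" and \<beta>: "0 < \<beta>" "\<beta> < 1" and c: "0 \<le> c"
    and i: "i \<in> K" "\<sigma> * x $ i \<le> a * \<beta> * exp (\<beta> * log_sum K x)"
    and strict: "(1 - (1 - \<beta>) * \<sigma>) * (1 + c) ^ card (- K) < 1"
    and semi: "\<And>h. 0 \<le> h \<bullet> (barrier_hessian K \<beta> a c x *v h)"
  shows "det (barrier_hessian K \<beta> a c x) < 1 / (\<Prod>i\<in>K. x $ i)"
proof -
  define s where "s = a * \<beta> * exp (\<beta> * log_sum K x)"
  have s: "0 \<le> s" using a \<beta> by (simp add: s_def)
  have pos: "0 < x $ j" if "j \<in> K" for j using x that by (simp add: orthant_def)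
  have P: "0 < (\<Prod>j\<in>K. x $ j)" using pos by (simp add: prod_pos)
  let ?D = "\<lambda>j. if j \<in> K then 1 / x $ j - s / (x $ j)\<^sup>2 else 1 + c"
  let ?w = "\<lambda>j. if j \<in> K then 1 / x $ j else 0"
  let ?t = "\<lambda>j. 1 - (1 - \<beta>) * s / x $ j"
  have H: "barrier_hessian K \<beta> a c x = diag_rank_one ?D (\<beta> * s) ?w"
    by (simp add: barrier_hessian_def s_def Let_def cong: if_cong)
  have \<beta>s: "0 \<le> \<beta> * s" using s \<beta> by simp
  have entry: "?D j + \<beta> * s * (?w j)\<^sup>2 = 1 / x $ j * ?t j" if "j \<in> K" for j
    using that pos[OF that] by (simp add: field_simps power2_eq_square)
  note bound = det_diag_rank_one_le[OF \<beta>s semi[unfolded H]]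
  have t: "0 \<le> ?t j" "?t j \<le> 1" if "j \<in> K" for j
  proof -
    have "0 \<le> 1 / x $ j * ?t j" using bound(2)[of j] entry[OF that] by simp
    then show "0 \<le> ?t j" using pos[OF that] by (simp only: zero_le_mult_iff) simp
    show "?t j \<le> 1" using pos[OF that] s \<beta> by simp
  qed
  have ti: "?t i \<le> 1 - (1 - \<beta>) * \<sigma>"
  proof -
    have "\<sigma> \<le> s / x $ i" using i pos[OF i(1)] by (simp add: s_def pos_le_divide_eq)
    then have "(1 - \<beta>) * \<sigma> \<le> (1 - \<beta>) * (s / x $ i)" using \<beta> by (intro mult_left_mono) auto
    then show ?thesis by simp
  qed
  have "(\<Prod>j\<in>K. ?t j) = ?t i * (\<Prod>j\<in>K - {i}. ?t j)"
    using i(1) by (simp add: prod.remove)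
  also have "\<dots> \<le> ?t i * 1"
    using t i(1) by (intro mult_left_mono prod_le_1) auto
  finally have T: "(\<Prod>j\<in>K. ?t j) \<le> 1 - (1 - \<beta>) * \<sigma>" using ti by simp
  have "det (barrier_hessian K \<beta> a c x) \<le> (\<Prod>j\<in>UNIV. ?D j + \<beta> * s * (?w j)\<^sup>2)"
    using bound(1) by (simp add: H)
  also have "\<dots> = (\<Prod>j\<in>K. 1 / x $ j * ?t j) * (\<Prod>j\<in>- K. 1 + c)"
    unfolding prod_split_on[of _ K] using entry
    by (intro arg_cong2[where f = "(*)"] prod.cong) auto
  also have "\<dots> = 1 / (\<Prod>j\<in>K. x $ j) * ((\<Prod>j\<in>K. ?t j) * (1 + c) ^ card (- K))"
    by (simp add: prod.distrib prod_dividef)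
  also have "\<dots> \<le> 1 / (\<Prod>j\<in>K. x $ j) * ((1 - (1 - \<beta>) * \<sigma>) * (1 + c) ^ card (- K))"
    using T P c by (intro mult_left_mono mult_right_mono) auto
  also have "\<dots> < 1 / (\<Prod>j\<in>K. x $ j) * 1"
    using strict P by (intro mult_strict_left_mono) auto
  finally show ?thesis by simp
qed

text \<open>Put \<open>s\<close> for \<open>\<beta>\<close> times the power term and \<open>z\<^sub>l = s / (x\<^sub>l + s)\<close>, with mean \<open>m\<close> over \<open>K\<close>. Relative to the density, the determinant is
\<open>(1 - (1 + \<delta>) m) / \<Prod>(1 - z\<^sub>l)\<close> times the power of \<open>1 - c\<close>, to which \<open>product_gain\<close> applies. The
coordinate \<open>j\<close>, not much smaller than \<open>s\<close>, keeps \<open>m\<close> away from \<open>1\<close>; the coordinate \<open>i\<close>, not much larger than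
\<open>s\<close>, keeps it away from \<open>0\<close>.\<close>

lemma lower_barrier_strict:
  fixes K :: "'n::finite set" and C :: real
  assumes x: "x \<in> orthant K" and k: "2 \<le> card K" and a: "0 < a" and c: "0 \<le> c" "c < 1"
    and C: "0 < C" and \<delta>: "\<delta> = 1 / (2 * card K * (1 + C))" and \<beta>: "\<beta> = (1 + \<delta>) / card K"
    and i: "i \<in> K" "\<sigma> * x $ i \<le> a * \<beta> * exp (\<beta> * log_sum K x)" "0 < \<sigma>"
    and j: "j \<in> K" "a * \<beta> * exp (\<beta> * log_sum K x) \<le> C * x $ j"
    and strict: "1 < (1 + \<delta> * (\<sigma> / (1 + \<sigma>) / card K)) * (1 - c) ^ card (- K)"
  shows "pos_def (barrier_hessian K \<beta> (- a) (- c) x)"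
    and "1 / (\<Prod>i\<in>K. x $ i) < det (barrier_hessian K \<beta> (- a) (- c) x)"
proof -
  define s where "s = a * \<beta> * exp (\<beta> * log_sum K x)"
  let ?k = "real (card K)"
  have k0: "0 < ?k" using k by simp
  have \<delta>0: "0 < \<delta>" using k0 C by (simp add: \<delta>)
  have \<beta>0: "0 < \<beta>" using k0 \<delta>0 by (simp add: \<beta>)
  have s: "0 < s" using a \<beta>0 by (simp add: s_def)
  have pos: "0 < x $ l" if "l \<in> K" for l using x that by (simp add: orthant_def)
  have P: "0 < (\<Prod>l\<in>K. x $ l)" using pos by (simp add: prod_pos)
  let ?D = "\<lambda>l. if l \<in> K then 1 / x $ l + s / (x $ l)\<^sup>2 else 1 - c"
  let ?w = "\<lambda>l. if l \<in> K then 1 / x $ l else 0"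
  define z where "z l = s / (x $ l + s)" for l
  define m where "m = (\<Sum>l\<in>K. z l) / ?k"
  have H: "barrier_hessian K \<beta> (- a) (- c) x = diag_rank_one ?D (- (\<beta> * s)) ?w"
    by (simp add: barrier_hessian_def s_def Let_def cong: if_cong)
  have D: "0 < ?D l" for l using pos[of l] s c by (auto intro!: add_pos_pos)
  have z: "0 \<le> z l \<and> z l < 1" if "l \<in> K" for l
    using pos[OF that] s by (simp add: z_def)
  have zi: "\<sigma> / (1 + \<sigma>) \<le> z i"
    using i(3) i(2)[folded s_def] pos[OF i(1)] s by (simp add: z_def field_simps)
  have zj: "z j \<le> 1 - 1 / (1 + C)"
    using j(2)[folded s_def] pos[OF j(1)] s C by (simp add: z_def field_simps)
  have "\<sigma> / (1 + \<sigma>) \<le> (\<Sum>l\<in>K. z l)"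
    using zi member_le_sum[of i K z] i(1) z by auto
  then have m_ge: "\<sigma> / (1 + \<sigma>) / ?k \<le> m"
    unfolding m_def using k0 by (intro divide_right_mono) auto
  have m_nonneg: "0 \<le> m" unfolding m_def using z by (intro divide_nonneg_nonneg sum_nonneg) auto
  have "(\<Sum>l\<in>K. z l) = z j + (\<Sum>l\<in>K - {j}. z l)"
    using j(1) by (simp add: sum.remove)
  also have "\<dots> \<le> (1 - 1 / (1 + C)) + (\<Sum>l\<in>K - {j}. 1)"
    using zj z by (intro add_mono sum_mono) (auto simp: less_imp_le)
  also have "\<dots> = ?k - 1 / (1 + C)"
    using j(1) k by (simp add: of_nat_diff)
  finally have "m \<le> (?k - 1 / (1 + C)) / ?k"
    using k0 by (simp add: m_def divide_right_mono)
  also have "\<dots> = 1 - 2 * \<delta>"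
    using k by (auto simp: \<delta> diff_divide_distrib mult.commute)
  finally have m_le: "m \<le> 1 - 2 * \<delta>" .
  have sum_w: "(\<Sum>l\<in>UNIV. (?w l)\<^sup>2 / ?D l) = (\<Sum>l\<in>K. 1 / (x $ l + s))"
  proof -
    have "(\<Sum>l\<in>UNIV. (?w l)\<^sup>2 / ?D l) = (\<Sum>l\<in>K. (?w l)\<^sup>2 / ?D l)"
      unfolding sum_split_on[of _ K] by simp
    also have "\<dots> = (\<Sum>l\<in>K. 1 / (x $ l + s))"
    proof (rule sum.cong[OF refl])
      fix l assume l: "l \<in> K"
      have "1 / x $ l + s / (x $ l)\<^sup>2 = (x $ l + s) / (x $ l)\<^sup>2"
        using pos[OF l] by (simp add: field_simps power2_eq_square)
      then show "(?w l)\<^sup>2 / ?D l = 1 / (x $ l + s)" using l pos[OF l] by (simp add: power_divide)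
    qed
    finally show ?thesis .
  qed
  have small: "\<beta> * s * (\<Sum>l\<in>UNIV. (?w l)\<^sup>2 / ?D l) = (1 + \<delta>) * m"
    using k0 by (simp add: sum_w m_def z_def \<beta> sum_distrib_left sum_divide_distrib mult.commute)
  have "(1 + \<delta>) * m \<le> (1 + \<delta>) * (1 - 2 * \<delta>)"
    using m_le \<delta>0 by (intro mult_left_mono) auto
  also have "\<dots> = 1 - \<delta> - 2 * (\<delta> * \<delta>)" by (simp add: algebra_simps)
  also have "\<dots> < 1" using \<delta>0 mult_pos_pos[OF \<delta>0 \<delta>0] by linarith
  finally have small1: "(1 + \<delta>) * m < 1" .
  have \<beta>s: "0 \<le> \<beta> * s" using s \<beta>0 by simp
  show "pos_def (barrier_hessian K \<beta> (- a) (- c) x)"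
    unfolding H by (rule pos_def_diag_minus_rank_one[OF D \<beta>s]) (use small small1 in simp)
  have "1 + \<delta> * (\<sigma> / (1 + \<sigma>) / ?k) \<le> 1 + m * (1 - \<delta> - m)"
  proof -
    have "\<sigma> / (1 + \<sigma>) / ?k * \<delta> \<le> m * (1 - \<delta> - m)"
      using m_ge m_le m_nonneg \<delta>0 by (intro mult_mono) auto
    then show ?thesis by (simp add: mult.commute)
  qed
  also have "\<dots> \<le> (1 - (1 + \<delta>) * m) / (\<Prod>l\<in>K. 1 - z l)"
    using m_le \<delta>0 by (intro product_gain[OF _ k z m_def]) auto
  finally have gain: "1 + \<delta> * (\<sigma> / (1 + \<sigma>) / ?k) \<le> (1 - (1 + \<delta>) * m) / (\<Prod>l\<in>K. 1 - z l)" .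
  have "(\<Prod>l\<in>K. ?D l) = (\<Prod>l\<in>K. 1 / x $ l / (1 - z l))"
  proof (rule prod.cong[OF refl])
    fix l assume l: "l \<in> K"
    have eq: "1 - z l = x $ l / (x $ l + s)" using pos[OF l] s by (simp add: z_def field_simps)
    show "?D l = 1 / x $ l / (1 - z l)"
      unfolding eq using l pos[OF l] s by (simp add: field_simps power2_eq_square)
  qed
  also have "\<dots> = 1 / (\<Prod>l\<in>K. x $ l) / (\<Prod>l\<in>K. 1 - z l)"
    by (simp add: prod_dividef prod.distrib)
  finally have prodD: "(\<Prod>l\<in>UNIV. ?D l) = 1 / (\<Prod>l\<in>K. x $ l) / (\<Prod>l\<in>K. 1 - z l) * (1 - c) ^ card (- K)"
    unfolding prod_split_on[of _ K] by simp
  have "1 / (\<Prod>i\<in>K. x $ i) * 1 < 1 / (\<Prod>i\<in>K. x $ i) * ((1 + \<delta> * (\<sigma> / (1 + \<sigma>) / ?k)) * (1 - c) ^ card (- K))"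
    using strict P by (intro mult_strict_left_mono) auto
  also have "\<dots> \<le> 1 / (\<Prod>i\<in>K. x $ i) * ((1 - (1 + \<delta>) * m) / (\<Prod>l\<in>K. 1 - z l) * (1 - c) ^ card (- K))"
    using gain P c by (intro mult_left_mono mult_right_mono) auto
  also have "\<dots> = (\<Prod>l\<in>UNIV. ?D l) * (1 - (1 + \<delta>) * m)"
    by (simp add: prodD)
  also have "\<dots> = det (barrier_hessian K \<beta> (- a) (- c) x)"
    unfolding H det_diag_rank_one_factored[of ?D, OF D] using small by simp
  finally show "1 / (\<Prod>i\<in>K. x $ i) < det (barrier_hessian K \<beta> (- a) (- c) x)" by simp
qed

section \<open>Comparison with the model solution\<close>

lemma exists_le_ge_average:
  fixes f :: "'a \<Rightarrow> real"
  assumes K: "finite K" "K \<noteq> {}"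
  obtains i j where "i \<in> K" "f i \<le> (\<Sum>l\<in>K. f l) / card K" "j \<in> K" "(\<Sum>l\<in>K. f l) / card K \<le> f j"
proof -
  let ?m = "(\<Sum>l\<in>K. f l) / card K"
  have sum: "(\<Sum>l\<in>K. ?m) = (\<Sum>l\<in>K. f l)" using K by simp
  have "\<exists>i\<in>K. f i \<le> ?m"
  proof (rule ccontr)
    assume "\<not> ?thesis"
    then have "(\<Sum>l\<in>K. ?m) < (\<Sum>l\<in>K. f l)" using K by (intro sum_strict_mono) auto
    with sum show False by simp
  qed
  moreover have "\<exists>j\<in>K. ?m \<le> f j"
  proof (rule ccontr)
    assume "\<not> ?thesis"
    then have "(\<Sum>l\<in>K. f l) < (\<Sum>l\<in>K. ?m)" using K by (intro sum_strict_mono) auto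
    with sum show False by simp
  qed
  ultimately show thesis using that by blast
qed

text \<open>All terms of the perturbation are nonnegative, so each of them separately is below the bound.\<close>

lemma perturbation_dominated:
  fixes K :: "'n::finite set"
  assumes K: "K \<noteq> {}" and C: "0 < C" and abc: "0 < a" "0 < b" "0 < c"
    and \<beta>: "\<beta> = (1 + \<delta>) / card K" and x: "x \<in> orthant K"
    and less: "perturbation K \<beta> a b c x < C * exp (log_sum K x / card K)"
  shows "a * exp (\<delta> * (log_sum K x / card K)) < C"
    and "b < C * exp (log_sum K x / card K)"
    and "i \<in> K \<Longrightarrow> b * x $ i < C * exp (log_sum K x / card K)"
    and "i \<notin> K \<Longrightarrow> c / 2 * (x $ i)\<^sup>2 < C * exp (log_sum K x / card K)"
proof -
  let ?g = "exp (log_sum K x / card K)"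
  have pos: "0 < x $ j" if "j \<in> K" for j using x that by (simp add: orthant_def)
  have exp: "exp (\<beta> * log_sum K x) = ?g * exp (\<delta> * (log_sum K x / card K))"
    by (simp add: \<beta> exp_add[symmetric] add_divide_distrib distrib_right)
  let ?A = "a * exp (\<beta> * log_sum K x)" and ?S = "\<Sum>i\<in>K. x $ i" and ?T = "\<Sum>i\<in>- K. (x $ i)\<^sup>2"
  have A: "0 < ?A" using abc by simp
  have S: "0 \<le> ?S" using pos by (simp add: sum_nonneg less_imp_le)
  have B: "b \<le> b * (1 + ?S)" using S abc by simp
  have T: "0 \<le> c / 2 * ?T" using abc by (simp add: sum_nonneg)
  have total: "?A + b * (1 + ?S) + c / 2 * ?T < C * ?g" using less by (simp add: perturbation_def)
  have "?A < C * ?g" using total B T abc by linarith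
  then show "a * exp (\<delta> * (log_sum K x / card K)) < C" by (simp add: exp)
  show "b < C * ?g" using total A B T by linarith
  show "b * x $ i < C * ?g" if "i \<in> K"
  proof -
    have "x $ i \<le> ?S" using that pos by (intro member_le_sum) (auto simp: less_imp_le)
    then have "b * x $ i \<le> b * (1 + ?S)" using abc by simp
    then show ?thesis using total A T by linarith
  qed
  show "c / 2 * (x $ i)\<^sup>2 < C * ?g" if "i \<notin> K"
  proof -
    have "(x $ i)\<^sup>2 \<le> ?T" using that by (intro member_le_sum) auto
    then have "c / 2 * (x $ i)\<^sup>2 \<le> c / 2 * ?T" using abc by simp
    then show ?thesis using total A B abc by linarith
  qed
qed

text \<open>The power term bounds the geometric mean \<open>g\<close> from above, the constant \<open>b\<close> bounds it from below, and the other two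
terms then bound all coordinates. A coordinate in \<open>K\<close> cannot be small either, since the product is
bounded below and the other factors are bounded above.\<close>

lemma perturbation_dominated_compact:
  fixes K :: "'n::finite set"
  assumes K: "K \<noteq> {}" and C: "0 < C" and abc: "0 < a" "0 < b" "0 < c"
    and \<delta>: "0 < \<delta>" and \<beta>: "\<beta> = (1 + \<delta>) / card K"
  obtains Q where "compact Q" "Q \<subseteq> orthant K"
    "\<And>x. x \<in> orthant K \<Longrightarrow> perturbation K \<beta> a b c x < C * exp (log_sum K x / card K) \<Longrightarrow> x \<in> Q"
proof -
  have k: "0 < real (card K)" using K by (simp add: card_gt_0_iff)
  define U where "U = ln (C / a) / \<delta>"
  define M where "M = C * exp U"
  define R where "R = M / b"
  define l where "l = exp (card K * ln (b / C) - (real (card K) - 1) * ln R)"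
  define R' where "R' = 1 + 2 * M / c"
  have M: "0 < M" using C by (simp add: M_def)
  have R: "0 < R" using M abc by (simp add: R_def)
  define Q :: "(real ^ 'n) set"
    where "Q = cbox (\<chi> i. if i \<in> K then l else - R') (\<chi> i. if i \<in> K then R else R')"
  show thesis
  proof
    show "compact Q" unfolding Q_def by (rule compact_cbox)
    have l: "0 < l" by (simp add: l_def)
    show "Q \<subseteq> orthant K"
    proof
      fix x assume "x \<in> Q"
      then have "l \<le> x $ i" if "i \<in> K" for i
        using that by (auto simp: Q_def mem_box_cart dest: spec[of _ i])
      then show "x \<in> orthant K" using l by (fastforce simp: orthant_def)
    qed
    fix x :: "real ^ 'n"
    assume x: "x \<in> orthant K" and less: "perturbation K \<beta> a b c x < C * exp (log_sum K x / card K)"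
    let ?L = "log_sum K x / card K"
    note dom = perturbation_dominated[OF K C abc \<beta> x less]
    have pos: "0 < x $ j" if "j \<in> K" for j using x that by (simp add: orthant_def)
    have "exp (\<delta> * ?L) < C / a" using dom(1) abc by (simp add: field_simps)
    then have "\<delta> * ?L < ln (C / a)" by (metis exp_gt_zero ln_exp ln_less_cancel_iff less_trans)
    then have "?L < U" using \<delta> by (simp add: U_def field_simps)
    then have g: "C * exp ?L < M" using C by (simp add: M_def)
    have upper: "x $ i \<le> R" if "i \<in> K" for i
      using dom(3)[OF that] g abc by (simp add: R_def field_simps)
    have outer: "\<bar>x $ i\<bar> \<le> R'" if "i \<notin> K" for i
    proof -
      have "(x $ i)\<^sup>2 \<le> 2 * M / c" using dom(4)[OF that] g abc by (simp add: field_simps)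
      moreover have "\<bar>x $ i\<bar> \<le> 1 + (x $ i)\<^sup>2"
      proof -
        have "0 \<le> (\<bar>x $ i\<bar> - 1/2)\<^sup>2" by simp
        then show ?thesis by (simp add: power2_diff power_divide)
      qed
      ultimately show ?thesis by (simp add: R'_def)
    qed
    have "b / C < exp ?L" using dom(2) C by (simp add: field_simps)
    then have "ln (b / C) < ?L" using abc C by (metis divide_pos_pos exp_gt_zero ln_exp ln_less_cancel_iff)
    then have L: "card K * ln (b / C) < log_sum K x" using k by (simp add: field_simps)
    have lower: "l \<le> x $ i" if i: "i \<in> K" for i
    proof -
      have "(\<Sum>j\<in>K - {i}. ln (x $ j)) \<le> (\<Sum>j\<in>K - {i}. ln R)"
        using upper pos R by (intro sum_mono) simp
      also have "\<dots> = (real (card K) - 1) * ln R"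
        using i k by (simp add: of_nat_diff Suc_leI)
      finally have "log_sum K x \<le> ln (x $ i) + (real (card K) - 1) * ln R"
        using i by (simp add: log_sum_def sum.remove)
      with L have "card K * ln (b / C) - (real (card K) - 1) * ln R \<le> ln (x $ i)" by linarith
      then have "l \<le> exp (ln (x $ i))" unfolding l_def by simp
      then show ?thesis using pos[OF i] by simp
    qed
    show "x \<in> Q"
      unfolding Q_def using lower upper outer by (auto simp: mem_box_cart abs_le_iff minus_le_iff)
  qed
qed

lemma interior_maximum:
  fixes D :: "'a::topological_space \<Rightarrow> real"
  assumes Q: "compact Q" "Q \<subseteq> \<Omega>" and D: "continuous_on \<Omega> D"
    and out: "\<And>x. x \<in> \<Omega> \<Longrightarrow> 0 < D x \<Longrightarrow> x \<in> Q" and y: "y \<in> \<Omega>" "0 < D y"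
  obtains z where "z \<in> \<Omega>" "0 < D z" "\<And>x. x \<in> \<Omega> \<Longrightarrow> D x \<le> D z"
proof -
  have "Q \<noteq> {}" using out[OF y] by blast
  from continuous_attains_sup[OF Q(1) this continuous_on_subset[OF D Q(2)]]
  obtain z where z: "z \<in> Q" "\<And>x. x \<in> Q \<Longrightarrow> D x \<le> D z" by blast
  have "0 < D z" using z(2)[OF out[OF y]] y(2) by linarith
  moreover have "D x \<le> D z" if "x \<in> \<Omega>" for x
    using z(2) out[OF that] \<open>0 < D z\<close> by (cases "0 < D x") auto
  ultimately show thesis using that z(1) Q(2) by blast
qed

text \<open>The two choices of the sign \<open>\<tau>\<close> compare \<open>u\<close> with the upper and with the lower barrier. A point \<open>y\<close> with a
positive gap fixes the size of the coefficients: each term of the perturbation takes at most a quarter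
of the gap at \<open>y\<close>.\<close>

lemma signed_gap_nonpos:
  fixes K :: "'n::finite set" and u :: "real ^ 'n \<Rightarrow> real" and C :: real
  assumes k: "2 \<le> card K"
    and sol: "alexandrov_solution (orthant K) (\<lambda>x. 1 / (\<Prod>a\<in>K. x $ a)) u"
    and C: "0 < C"
      "\<And>x. x \<in> orthant K \<Longrightarrow> \<bar>u x - model_solution K x\<bar> \<le> C * exp (log_sum K x / card K)"
    and y: "y \<in> orthant K" and sgn: "\<tau> = 1 \<or> \<tau> = -1"
  shows "\<tau> * (u y - model_solution K y) \<le> 0"
proof (rule ccontr)
  let ?\<Omega> = "orthant K" and ?k = "real (card K)" and ?f = "\<lambda>x::real ^ 'n. 1 / (\<Prod>a\<in>K. x $ a)"
  let ?N = "card (- K)"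
  define gap where "gap = \<tau> * (u y - model_solution K y)"
  assume "\<not> ?thesis"
  then have gap: "0 < gap" by (simp add: gap_def)
  have K: "K \<noteq> {}" and k0: "0 < ?k" using k by auto
  have pos: "0 < x $ i" if "x \<in> ?\<Omega>" "i \<in> K" for x i using that by (simp add: orthant_def)
  (* At a maximum the power term is at most C times the geometric mean, so the mean m in
    lower_barrier_strict is at most 1 - 1 / (k (1 + C)) = 1 - 2 \<delta>, which leaves room for product_gain. *)
  define \<delta> where "\<delta> = 1 / (2 * ?k * (1 + C))"
  define \<beta> where "\<beta> = (1 + \<delta>) / ?k"
  have \<delta>: "0 < \<delta>" using k0 C by (simp add: \<delta>_def)
  have "1 * 1 < 2 * ?k * (1 + C)"
    using k C(1) by (intro mult_strict_mono) auto
  then have "\<delta> < 1" unfolding \<delta>_def by (simp only: divide_less_eq_1) linarith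
  then have \<beta>: "0 < \<beta>" "\<beta> < 1" using \<delta> k by (simp_all add: \<beta>_def field_simps)
  define a where "a = gap / (4 * exp (\<beta> * log_sum K y))"
  define b where "b = gap / (4 * (1 + (\<Sum>i\<in>K. y $ i)))"
  have S: "0 \<le> (\<Sum>i\<in>K. y $ i)" using pos[OF y] by (simp add: sum_nonneg less_imp_le)
  have ab: "0 < a" "0 < b" using gap S by (simp_all add: a_def b_def)
  (* At a maximum the geometric mean exceeds b / C; \<sigma> is the resulting lower bound for the ratio of
    \<beta> times the power term to the geometric mean. It does not depend on c, so c can be chosen after it. *)
  define \<sigma> where "\<sigma> = a * \<beta> * exp (\<delta> * ln (b / C))"
  have \<sigma>: "0 < \<sigma>" using ab \<beta> by (simp add: \<sigma>_def)
  have "((\<lambda>c. (1 - (1 - \<beta>) * \<sigma>) * (1 + c) ^ ?N) \<longlongrightarrow> (1 - (1 - \<beta>) * \<sigma>) * (1 + 0) ^ ?N) (at_right 0)"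
    by (intro tendsto_intros)
  then have ev1: "\<forall>\<^sub>F c in at_right 0. (1 - (1 - \<beta>) * \<sigma>) * (1 + c) ^ ?N < 1"
    by (rule order_tendstoD(2)) (use \<beta> \<sigma> in simp)
  have "((\<lambda>c. (1 + \<delta> * (\<sigma> / (1 + \<sigma>) / ?k)) * (1 - c) ^ ?N)
      \<longlongrightarrow> (1 + \<delta> * (\<sigma> / (1 + \<sigma>) / ?k)) * (1 - 0) ^ ?N) (at_right 0)"
    by (intro tendsto_intros)
  then have ev2: "\<forall>\<^sub>F c in at_right 0. 1 < (1 + \<delta> * (\<sigma> / (1 + \<sigma>) / ?k)) * (1 - c) ^ ?N"
    by (rule order_tendstoD(1)) (use \<delta> \<sigma> k0 in simp)
  have "((\<lambda>c. c / 2 * (\<Sum>i\<in>- K. (y $ i)\<^sup>2)) \<longlongrightarrow> 0 / 2 * (\<Sum>i\<in>- K. (y $ i)\<^sup>2)) (at_right 0)"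
    by (intro tendsto_intros) simp
  then have ev3: "\<forall>\<^sub>F c in at_right 0. c / 2 * (\<Sum>i\<in>- K. (y $ i)\<^sup>2) < gap / 4"
    by (rule order_tendstoD(2)) (use gap in simp)
  have ev4: "\<forall>\<^sub>F c::real in at_right 0. 0 < c" by (rule eventually_at_right_less)
  have ev5: "\<forall>\<^sub>F c::real in at_right 0. c < 1"
    by (rule order_tendstoD(2)[OF tendsto_ident_at]) simp
  have "\<forall>\<^sub>F c in at_right 0. (1 - (1 - \<beta>) * \<sigma>) * (1 + c) ^ ?N < 1
      \<and> 1 < (1 + \<delta> * (\<sigma> / (1 + \<sigma>) / ?k)) * (1 - c) ^ ?N
      \<and> c / 2 * (\<Sum>i\<in>- K. (y $ i)\<^sup>2) < gap / 4 \<and> 0 < c \<and> c < 1"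
    using ev1 ev2 ev3 ev4 ev5 by eventually_elim simp
  then obtain c where c: "(1 - (1 - \<beta>) * \<sigma>) * (1 + c) ^ ?N < 1"
      "1 < (1 + \<delta> * (\<sigma> / (1 + \<sigma>) / ?k)) * (1 - c) ^ ?N"
      "c / 2 * (\<Sum>i\<in>- K. (y $ i)\<^sup>2) < gap / 4" "0 < c" "c < 1"
    using eventually_happens'[OF trivial_limit_at_right_real] by blast
  define v where "v = barrier K \<beta> (\<tau> * a) (\<tau> * b) (\<tau> * c)"
  define G where "G = barrier_gradient K \<beta> (\<tau> * a) (\<tau> * b) (\<tau> * c)"
  define H where "H = barrier_hessian K \<beta> (\<tau> * a) (\<tau> * c)"
  have v: "v x = model_solution K x + \<tau> * perturbation K \<beta> a b c x" for x
    by (simp add: v_def barrier_def perturbation_def algebra_simps)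
  have v_deriv: "(v has_derivative (\<lambda>h. G x \<bullet> h)) (at x)" if "x \<in> ?\<Omega>" for x
    unfolding v_def G_def by (rule barrier_has_derivative[OF that])
  have G_deriv: "(G has_derivative (*v) (H x)) (at x)" if "x \<in> ?\<Omega>" for x
    unfolding G_def H_def by (rule barrier_gradient_has_derivative[OF that])
  have H_cont: "continuous_on ?\<Omega> H"
    unfolding H_def by (rule continuous_on_barrier_hessian)
  let ?D = "\<lambda>x. \<tau> * (u x - v x)"
  have D: "?D x = \<tau> * (u x - model_solution K x) - perturbation K \<beta> a b c x" for x
    using sgn by (auto simp: v)
  have "perturbation K \<beta> a b c y < gap"
  proof -
    have "a * exp (\<beta> * log_sum K y) = gap / 4" by (simp add: a_def)
    moreover have "b * (1 + (\<Sum>i\<in>K. y $ i)) = gap / 4"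
    proof -
      have "g / (4 * t) * t = g / 4" if "0 < t" for g t :: real using that by simp
      from this[of "1 + (\<Sum>i\<in>K. y $ i)" gap] show ?thesis using S by (simp add: b_def)
    qed
    ultimately show ?thesis using c(3) gap by (simp add: perturbation_def)
  qed
  then have Dy: "0 < ?D y" by (simp add: D gap_def)
  have dominated: "perturbation K \<beta> a b c x < C * exp (log_sum K x / ?k)" if "x \<in> ?\<Omega>" "0 < ?D x" for x
  proof -
    have "\<tau> * (u x - model_solution K x) \<le> \<bar>u x - model_solution K x\<bar>" using sgn by auto
    then show ?thesis using C(2)[OF that(1)] that(2) D[of x] by linarith
  qed
  obtain Q where Q: "compact Q" "Q \<subseteq> ?\<Omega>"
    "\<And>x. x \<in> ?\<Omega> \<Longrightarrow> perturbation K \<beta> a b c x < C * exp (log_sum K x / ?k) \<Longrightarrow> x \<in> Q"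
    using perturbation_dominated_compact[OF K C(1) ab c(4) \<delta> \<beta>_def] by blast
  have cont_u: "continuous_on ?\<Omega> u"
    by (rule convex_on_continuous[OF open_orthant]) (use sol in \<open>simp add: alexandrov_solution_def\<close>)
  have cont_v: "continuous_on ?\<Omega> v"
    using has_derivative_continuous[OF v_deriv] by (intro continuous_at_imp_continuous_on) auto
  have "continuous_on ?\<Omega> ?D" by (intro continuous_intros cont_u cont_v)
  from interior_maximum[OF Q(1,2) this Q(3)[OF _ dominated] y Dy]
  obtain z where z: "z \<in> ?\<Omega>" "0 < ?D z" and max: "\<And>x. x \<in> ?\<Omega> \<Longrightarrow> ?D x \<le> ?D z" by blast
  let ?g = "exp (log_sum K z / ?k)" and ?s = "a * \<beta> * exp (\<beta> * log_sum K z)"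
  note dom = perturbation_dominated(1,2)[OF K C(1) ab c(4) \<beta>_def z(1) dominated[OF z]]
  have "ln (b / C) \<le> log_sum K z / ?k"
  proof -
    have "b / C < ?g" using dom(2) C(1) by (simp add: field_simps)
    then have "ln (b / C) < ln ?g" using ab C(1) by (subst ln_less_cancel_iff) auto
    then show ?thesis by simp
  qed
  then have low: "\<sigma> \<le> a * \<beta> * exp (\<delta> * (log_sum K z / ?k))"
    unfolding \<sigma>_def using ab \<beta> \<delta>
    by (intro mult_left_mono exp_le_cancel_iff[THEN iffD2]) simp_all
  have s: "?s = (a * \<beta> * exp (\<delta> * (log_sum K z / ?k))) * ?g"
  proof -
    have "exp (\<beta> * log_sum K z) = exp (\<delta> * (log_sum K z / ?k)) * ?g"
      by (simp add: \<beta>_def exp_add[symmetric] add_divide_distrib distrib_right add.commute)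
    then show ?thesis by simp
  qed
  have s_low: "\<sigma> * ?g \<le> ?s" unfolding s using low by (intro mult_right_mono) auto
  have s_high: "?s \<le> C * ?g"
  proof -
    have "\<beta> * (a * exp (\<delta> * (log_sum K z / ?k))) \<le> 1 * C"
      using dom(1) \<beta> ab by (intro mult_mono) (auto simp: less_imp_le)
    then show ?thesis unfolding s by (intro mult_right_mono) (auto simp: mult_ac)
  qed
  obtain i j where ij: "i \<in> K" "ln (z $ i) \<le> log_sum K z / ?k" "j \<in> K" "log_sum K z / ?k \<le> ln (z $ j)"
    using exists_le_ge_average[OF _ K, of "\<lambda>i. ln (z $ i)"] unfolding log_sum_def by auto
  have zi: "z $ i \<le> ?g" using ij(2) pos[OF z(1) ij(1)] exp_le_cancel_iff exp_ln by metis
  have zj: "?g \<le> z $ j" using ij(4) pos[OF z(1) ij(3)] exp_le_cancel_iff exp_ln by metis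
  have i: "\<sigma> * z $ i \<le> ?s" using mult_left_mono[OF zi, of \<sigma>] \<sigma> s_low by linarith
  have j: "?s \<le> C * z $ j" using mult_left_mono[OF zj, of C] C(1) s_high by linarith
  have f_pos: "0 < ?f x" if "x \<in> ?\<Omega>" for x using pos[OF that] by (simp add: prod_pos)
  have f_cont: "continuous_on ?\<Omega> ?f"
    using f_pos by (intro continuous_intros) (metis divide_eq_0_iff less_irrefl)
  show False
  proof (cases "\<tau> = 1")
    case True
    note above = alexandrov_touching_above[OF sol open_orthant f_cont z(1) v_deriv G_deriv H_cont]
    have touch: "u x - v x \<le> u z - v z" if "x \<in> ?\<Omega>" for x using max[OF that] True by simp
    have "det (H z) < ?f z"
      using above(1)[OF _ _ touch] True ab c
      unfolding H_def by (intro upper_barrier_strict[OF z(1) _ \<beta> _ ij(1), where \<sigma> = \<sigma>]) (simp_all add: i)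
    moreover have "?f z \<le> det (H z)" by (rule above(2)[OF _ _ touch])
    ultimately show False by simp
  next
    case False
    then have \<tau>: "\<tau> = -1" using sgn by simp
    have touch: "u z - v z \<le> u x - v x" if "x \<in> ?\<Omega>" for x using max[OF that] \<tau> by simp
    have strict: "pos_def (H z)" "?f z < det (H z)"
      using lower_barrier_strict[OF z(1) k ab(1) less_imp_le[OF c(4)] c(5) C(1) _ _ ij(1) i \<sigma> ij(3) j c(2)]
      by (simp_all add: \<tau> H_def \<delta>_def \<beta>_def)
    have "det (H z) \<le> ?f z"
      by (rule alexandrov_touching_below[OF sol open_orthant f_cont f_pos z(1) v_deriv G_deriv H_cont strict(1) touch])
    with strict(2) show False by simp
  qed
qed

theorem theorem1p2:
  fixes K :: "'n::finite set" and u :: "real ^ 'n \<Rightarrow> real"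
  assumes "2 \<le> card K"
    and "continuous_on (closure (orthant K)) u"
    and "alexandrov_solution (orthant K) (\<lambda>x. 1 / (\<Prod>a\<in>K. x $ a)) u"
    and "\<And>x. x \<in> frontier (orthant K) \<Longrightarrow> u x = model_solution K x"
    and "\<exists>C. \<forall>x\<in>orthant K.
      \<bar>u x - model_solution K x\<bar> \<le> C * (\<Prod>a\<in>K. x $ a) powr (1 / real (card K))"
  shows "\<forall>x\<in>closure (orthant K). u x = model_solution K x"
proof
  fix x assume x: "x \<in> closure (orthant K)"
  obtain C where C: "\<And>x. x \<in> orthant K \<Longrightarrow>
      \<bar>u x - model_solution K x\<bar> \<le> C * (\<Prod>a\<in>K. x $ a) powr (1 / real (card K))"
    using assms(5) by blast
  have bound: "\<bar>u x - model_solution K x\<bar> \<le> max C 1 * exp (log_sum K x / card K)"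
    if x: "x \<in> orthant K" for x
  proof -
    have pos: "0 < x $ i" if "i \<in> K" for i using x that by (simp add: orthant_def)
    have "(\<Prod>a\<in>K. x $ a) powr (1 / real (card K)) = exp (log_sum K x / card K)"
      using pos by (simp add: powr_def prod_pos ln_prod log_sum_def less_imp_neq[symmetric])
    then have "\<bar>u x - model_solution K x\<bar> \<le> C * exp (log_sum K x / card K)" using C[OF x] by simp
    also have "\<dots> \<le> max C 1 * exp (log_sum K x / card K)" by (intro mult_right_mono) auto
    finally show ?thesis .
  qed
  have gap: "\<tau> * (u x - model_solution K x) \<le> 0" if "x \<in> orthant K" "\<tau> = 1 \<or> \<tau> = -1" for \<tau>
    using signed_gap_nonpos[OF assms(1,3) _ bound that] by simp
  show "u x = model_solution K x"
  proof (cases "x \<in> orthant K")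
    case True
    then show ?thesis using gap[OF True, of 1] gap[OF True, of "-1"] by simp
  next
    case False
    then show ?thesis using x assms(4)[of x] open_orthant[of K] by (simp add: frontier_def interior_open)
  qed
qed

end
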